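(* Let $n\ge 1$ and $x=(x_1,\dots,x_n)$. If $\lambda$ is an $n$-partition, then $$\mathrm{s}^{\mathrm{CB}}_{\lambda}(x;\beta) = \frac{\det_{1\le i,j\le n}\left( x_j^{\lambda_i + n-i+1} - x_j^{-(\lambda_i + n-i+1)} + \beta \left[x_j^{\lambda_i + n-i} - x_j^{-(\lambda_i + n-i)}\right] \right)}{\det_{1\le i,j\le n}\left( x_j^{n-i+1} - x_j^{-(n-i+1)} \right)} .$$ If $\lambda$ is an $n$-half-partition, then $$\mathrm{s}^{\mathrm{CB}}_{\lambda}(x;\beta) = \frac{\det_{1\le i,j\le n}\left( \left[\beta x_j^{1/2} + x_j^{-1/2}\right] \left[ x_j^{\lambda_i + n-i+1/2} - x_j^{-(\lambda_i + n-i+1/2)} \right] \right)}{\det_{1\le i,j\le n}\left( x_j^{n-i+1} - x_j^{-(n-i+1)} \right)} .$$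
   Context: A half-integer is an element of $\frac12+\mathbb{Z}$. An $n$-partition (resp. $n$-half-partition) is an $n$-tuple $\lambda_1\ge\dots\ge\lambda_n\ge 0$ of integers (resp. of half-integers). A half-triangular array of height $2n$ is $z=(z_{i,j})_{1\le i\le 2n,\,1\le j\le\lceil i/2\rceil}$. The interlacing conditions are $z_{i+1,j+1}\le z_{i,j}\le z_{i+1,j}$, each inequality being required whenever both entries exist. The shape of $z$ is its last row $(z_{2n,1},\dots,z_{2n,n})$, and $\mathrm{type}(z)_i=\sum_{j=1}^{\lceil i/2\rceil}z_{i,j}-\sum_{j=1}^{\lceil (i-1)/2\rceil}z_{i-1,j}$ for $1\le i\le 2n$. A split orthogonal pattern of height $2n$ is such an array satisfying the interlacing conditions for which the odd ends $z_{2i-1,i}$ ($1\le i\le n$) lie in $\frac12\mathbb{Z}_{\ge0}$, and all the other entries lie either all in $\mathbb{Z}_{\ge 0}$ or all in $\frac12+\mathbb{Z}_{\ge0}$; $\mathrm{soP}^{(2n)}_\lambda$ is the set of those of shape $\lambda$. If $z_{2n,1}$ is an integer (resp. half-integer), the atypical entries of $z$ are its half-integer (resp. integer) entries (necessarily odd ends); $|\mathfrak a(z)|$ denotes their number. The CB-interpolating Schur polynomial with parameter $\beta$ indexed by an $n$-partition or $n$-half-partition $\lambda$ is $$\mathrm{s}^{\mathrm{CB}}_\lambda(x;\beta)=\sum_{z\in\mathrm{soP}^{(2n)}_\lambda}\beta^{|\mathfrak a(z)|}\prod_{i=1}^n x_i^{\mathrm{type}(z)_{2i}-\mathrm{type}(z)_{2i-1}}$$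 (with $0^0=1$). The identities are between rational functions (in the $x_i^{1/2}$ when half-integer exponents occur). *)

theory Defs
  imports
    "HOL-Library.Poly_Mapping"
    "HOL-Computational_Algebra.Fraction_Field"
    "Jordan_Normal_Form.Determinant"
begin

subsection \<open>Half-integers and partitions\<close>

text \<open>Integers and half-integers are taken inside \<^typ>\<open>rat\<close>.\<close>

definition half_integers :: "rat set" where
  "half_integers = {1/2 + of_int k | k. True}"

text \<open>
  An \<open>n\<close>-tuple is a function on the indices \<open>1, \<dots>, n\<close>; its values elsewhere are irrelevant.
\<close>

definition is_partition :: "nat \<Rightarrow> (nat \<Rightarrow> rat) \<Rightarrow> bool" where
  "is_partition n lam \<longleftrightarrow>
     (\<forall>i\<in>{1..n}. lam i \<in> \<int> \<and> lam i \<ge> 0) \<and>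
     (\<forall>i\<in>{1..n}. \<forall>j\<in>{1..n}. i \<le> j \<longrightarrow> lam i \<ge> lam j)"

definition is_half_partition :: "nat \<Rightarrow> (nat \<Rightarrow> rat) \<Rightarrow> bool" where
  "is_half_partition n lam \<longleftrightarrow>
     (\<forall>i\<in>{1..n}. lam i \<in> half_integers \<and> lam i \<ge> 0) \<and>
     (\<forall>i\<in>{1..n}. \<forall>j\<in>{1..n}. i \<le> j \<longrightarrow> lam i \<ge> lam j)"


subsection \<open>Half-triangular arrays and split orthogonal patterns\<close>

text \<open>Row \<open>i\<close> has \<open>\<lceil>i/2\<rceil>\<close> entries, written \<open>(i + 1) div 2\<close>.\<close>

definition array_indices :: "nat \<Rightarrow> (nat \<times> nat) set" where
  "array_indices n = {(i, j). 1 \<le> i \<and> i \<le> 2 * n \<and> 1 \<le> j \<and> j \<le> (i + 1) div 2}"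

definition odd_ends :: "nat \<Rightarrow> (nat \<times> nat) set" where
  "odd_ends n = {(2 * i - 1, i) | i. 1 \<le> i \<and> i \<le> n}"

definition interlacing :: "nat \<Rightarrow> (nat \<times> nat \<Rightarrow> rat) \<Rightarrow> bool" where
  "interlacing n z \<longleftrightarrow>
     (\<forall>i j. (i, j) \<in> array_indices n \<longrightarrow>
        ((i + 1, j + 1) \<in> array_indices n \<longrightarrow> z (i + 1, j + 1) \<le> z (i, j)) \<and>
        ((i + 1, j) \<in> array_indices n \<longrightarrow> z (i, j) \<le> z (i + 1, j)))"

text \<open>
  For \<open>i = 1\<close> the second sum is empty, since \<open>\<lceil>(i - 1)/2\<rceil> = i div 2\<close> for \<open>i \<ge> 1\<close>.
\<close>

definition array_type :: "(nat \<times> nat \<Rightarrow> rat) \<Rightarrow> nat \<Rightarrow> rat" where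
  "array_type z i = (\<Sum>j=1..(i + 1) div 2. z (i, j)) - (\<Sum>j=1..i div 2. z (i - 1, j))"

text \<open>
  An array is represented by a total function on pairs, fixed to be \<open>0\<close> outside the index set so
  that distinct functions are distinct arrays and the set below is finite.
\<close>

definition so_patterns :: "nat \<Rightarrow> (nat \<Rightarrow> rat) \<Rightarrow> (nat \<times> nat \<Rightarrow> rat) set" where
  "so_patterns n lam = {z.
     (\<forall>p. p \<notin> array_indices n \<longrightarrow> z p = 0) \<and>
     interlacing n z \<and>
     (\<forall>p\<in>odd_ends n. z p \<in> \<int> \<union> half_integers \<and> z p \<ge> 0) \<and>
     ((\<forall>p\<in>array_indices n - odd_ends n. z p \<in> \<int> \<and> z p \<ge> 0) \<or>
      (\<forall>p\<in>array_indices n - odd_ends n. z p \<in> half_integers \<and> z p \<ge> 0)) \<and>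
     (\<forall>j\<in>{1..n}. z (2 * n, j) = lam j)}"

definition atypical :: "nat \<Rightarrow> (nat \<times> nat \<Rightarrow> rat) \<Rightarrow> (nat \<times> nat) set" where
  "atypical n z =
     (if z (2 * n, 1) \<in> \<int> then {p \<in> array_indices n. z p \<in> half_integers}
      else {p \<in> array_indices n. z p \<in> \<int>})"


subsection \<open>CB-interpolating Schur polynomials\<close>

text \<open>
  \<open>half_pow y e\<close> is \<open>x\<^sup>e\<close> for \<open>e \<in> \<int> \<union> half_integers\<close>, where \<open>y\<close> plays the role of the square
  root \<open>x\<^bsup>1/2\<^esup>\<close>; \<open>2 * e\<close> is then an integer and the floor only converts its type.
\<close>

definition half_pow :: "'a::field \<Rightarrow> rat \<Rightarrow> 'a" where
  "half_pow y e = y powi \<lfloor>2 * e\<rfloor>"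

text \<open>The arguments \<open>y i\<close> are the square roots \<open>x\<^sub>i\<^bsup>1/2\<^esup>\<close>.\<close>

definition schur_CB :: "nat \<Rightarrow> (nat \<Rightarrow> rat) \<Rightarrow> (nat \<Rightarrow> 'a::field) \<Rightarrow> 'a \<Rightarrow> 'a" where
  "schur_CB n lam y \<beta> =
     (\<Sum>z\<in>so_patterns n lam. \<beta> ^ card (atypical n z) *
        (\<Prod>i=1..n. half_pow (y i) (array_type z (2 * i) - array_type z (2 * i - 1))))"

text \<open>The determinant of the matrix with entry \<open>f i j\<close> in row \<open>i\<close>, column \<open>j\<close>, \<open>1 \<le> i, j \<le> n\<close>.\<close>

definition det_1n :: "nat \<Rightarrow> (nat \<Rightarrow> nat \<Rightarrow> 'a::comm_ring_1) \<Rightarrow> 'a" where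
  "det_1n n f = det (mat n n (\<lambda>(i, j). f (i + 1) (j + 1)))"


subsection \<open>Rational functions\<close>

text \<open>
  \<open>(nat \<Rightarrow>\<^sub>0 nat) \<Rightarrow>\<^sub>0 'k\<close> is the polynomial ring over \<open>'k\<close> in indeterminates indexed by \<^typ>\<open>nat\<close>
  (finitely supported coefficient functions on monomials, with convolution product).
  The indeterminates are the \<open>x\<^sub>i\<^bsup>1/2\<^esup>\<close>, so that \<open>x\<^sub>i = (root_x i)\<^sup>2\<close>.
\<close>

type_synonym 'k ratfun = "((nat \<Rightarrow>\<^sub>0 nat) \<Rightarrow>\<^sub>0 'k) fract"

definition root_x :: "nat \<Rightarrow> 'k::field ratfun" where
  "root_x i = Fract (Poly_Mapping.single (Poly_Mapping.single i 1) 1) 1"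

definition const_ratfun :: "'k::field \<Rightarrow> 'k ratfun" where
  "const_ratfun c = Fract (Poly_Mapping.single 0 c) 1"

end

theory Submission
  imports Defs "HOL-Library.FuncSet"
begin

text \<open>
  Induction on \<open>n\<close>, removing the last two rows of a pattern. Write \<open>l\<^sub>i = \<lambda>\<^sub>i + n - i\<close>, let \<open>\<phi>\<^sub>l(x)\<close> be the
  entry of the numerator, and let \<open>t\<close> be the last variable. In both cases
  \<open>\<phi>\<^sub>l\<^sub>+\<^sub>1 + \<phi>\<^sub>l\<^sub>-\<^sub>1 = (x + 1/x) \<phi>\<^sub>l\<close>, so \<open>(x + 1/x - t - 1/t) t\<^sup>m \<phi>\<^sub>m\<close> is the difference \<open>g\<^sub>m\<^sub>+\<^sub>1 - g\<^sub>m\<close> of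
  \<open>g\<^sub>m = t\<^sup>m\<^sup>-\<^sup>1 \<phi>\<^sub>m - t\<^sup>m \<phi>\<^sub>m\<^sub>-\<^sub>1\<close>, and \<open>t\<close> to the power \<open>-2 m\<close> times \<open>g\<^sub>m\<close> is in turn the difference
  \<open>V\<^sub>m - V\<^sub>m\<^sub>-\<^sub>1\<close> of \<open>V\<^sub>m = t\<^sup>-\<^sup>m\<^sup>-\<^sup>1 \<phi>\<^sub>m\<close>. Interlacing makes the entries of each removed row range
  over independent intervals, so by multilinearity both row sums telescope inside a determinant.
  At \<open>x = t\<close> the function \<open>g\<close> is constant, which supplies the extra column when the size grows
  from \<open>n - 1\<close> to \<open>n\<close>. The odd end contributes the factor \<open>1 + \<beta> t\<close> to the last row, and this
  factor cancels against the constant value of \<open>g\<close>.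
\<close>

subsection \<open>Integers and half-integers\<close>

text \<open>For \<open>\<epsilon> = 0\<close> and \<open>\<epsilon> = 1/2\<close> these are the
  integers and the half-integers, so one induction serves both cases of the theorem.\<close>

definition int_coset :: "rat \<Rightarrow> rat set" where
  "int_coset \<epsilon> = {\<epsilon> + of_int k | k. True}"

definition half_lattice :: "rat set" where
  "half_lattice = {q. 2 * q \<in> \<int>}"

lemma int_coset_0: "int_coset 0 = \<int>"
  by (auto simp: int_coset_def Ints_def)

lemma int_coset_half: "int_coset (1/2) = half_integers"
  by (simp add: int_coset_def half_integers_def)

lemma int_coset_add_int [intro]: "q \<in> int_coset \<epsilon> \<Longrightarrow> r \<in> \<int> \<Longrightarrow> q + r \<in> int_coset \<epsilon>"
  unfolding int_coset_def Ints_def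
  by (clarsimp, metis add.assoc of_int_add)

lemma int_coset_diffE:
  assumes "a \<in> int_coset \<epsilon>" "b \<in> int_coset \<epsilon>"
  obtains k where "b = a + of_int k"
proof -
  from assms obtain i j where "a = \<epsilon> + of_int i" "b = \<epsilon> + of_int j"
    by (auto simp: int_coset_def)
  then have "b = a + of_int (j - i)" by simp
  then show ?thesis by (rule that)
qed

lemma half_lattice_closed [simp, intro]:
  "0 \<in> half_lattice" "1 \<in> half_lattice" "of_nat n \<in> half_lattice" "1/2 \<in> half_lattice"
  "a \<in> half_lattice \<Longrightarrow> b \<in> half_lattice \<Longrightarrow> a + b \<in> half_lattice"
  "a \<in> half_lattice \<Longrightarrow> b \<in> half_lattice \<Longrightarrow> a - b \<in> half_lattice"
  "a \<in> half_lattice \<Longrightarrow> - a \<in> half_lattice"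
  by (simp_all add: half_lattice_def distrib_left right_diff_distrib)

lemma double_in_half_lattice [simp, intro]: "a \<in> half_lattice \<Longrightarrow> 2 * a \<in> half_lattice"
  unfolding mult_2 by (rule half_lattice_closed(5))

lemma sum_in_half_lattice: "(\<And>i. i \<in> I \<Longrightarrow> f i \<in> half_lattice) \<Longrightarrow> sum f I \<in> half_lattice"
  by (induction I rule: infinite_finite_induct) auto

lemma half_lattice_eq_Un: "half_lattice = \<int> \<union> half_integers"
proof
  show "half_lattice \<subseteq> \<int> \<union> half_integers"
  proof
    fix q assume "q \<in> half_lattice"
    then obtain k where k: "2 * q = of_int k"
      by (auto simp: half_lattice_def Ints_def)
    show "q \<in> \<int> \<union> half_integers"
    proof (cases "even k")
      case True
      then obtain m where "k = 2 * m" by blast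
      with k have "q = of_int m" by simp
      then show ?thesis by simp
    next
      case False
      then obtain m where "k = 2 * m + 1" by (blast elim: oddE)
      with k have "q = 1/2 + of_int m" by simp
      then show ?thesis by (auto simp: half_integers_def)
    qed
  qed
  show "\<int> \<union> half_integers \<subseteq> half_lattice"
    by (auto simp: half_lattice_def half_integers_def distrib_left)
qed

lemma Ints_half_integers_disjoint: "q \<in> \<int> \<Longrightarrow> q \<notin> half_integers"
proof
  assume "q \<in> \<int>" "q \<in> half_integers"
  then obtain i k :: int where "of_int i = (1/2 :: rat) + of_int k"
    by (auto simp: half_integers_def Ints_def)
  then have "of_int (2 * i) = (of_int (1 + 2 * k) :: rat)" by simp
  then have "2 * i = 1 + 2 * k" by (simp only: of_int_eq_iff)
  then show False by presburger
qed

lemma int_coset_sub_half_lattice: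
  assumes "\<epsilon> = 0 \<or> \<epsilon> = 1/2"
  shows "int_coset \<epsilon> \<subseteq> half_lattice"
  using assms
proof
  assume "\<epsilon> = 0"
  then show ?thesis unfolding half_lattice_eq_Un by (simp add: int_coset_0)
next
  assume "\<epsilon> = 1/2"
  show ?thesis unfolding half_lattice_eq_Un \<open>\<epsilon> = 1/2\<close> int_coset_half by (rule Un_upper2)
qed

text \<open>\<open>half_lattice\<close> is the disjoint union of the two cosets, and the shift by
  1/2 exchanges them. This is how an atypical odd end is compared with a typical value.\<close>

lemma add_half_in_int_coset_iff:
  assumes "\<epsilon> = 0 \<or> \<epsilon> = 1/2" "q \<in> half_lattice"
  shows "q + 1/2 \<in> int_coset \<epsilon> \<longleftrightarrow> q \<notin> int_coset \<epsilon>"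
proof -
  have *: "q + 1/2 \<in> half_integers" if "q \<in> \<int>"
    using that by (auto simp: half_integers_def Ints_def)
  have **: "q + 1/2 \<in> \<int>" if "q \<in> half_integers"
    using that by (auto simp: half_integers_def)
  show ?thesis
    using assms(1)
  proof
    assume "\<epsilon> = 0"
    then show ?thesis
      using assms(2) * ** Ints_half_integers_disjoint[of "q + 1/2"]
      by (auto simp only: int_coset_0 half_lattice_eq_Un)
  next
    assume "\<epsilon> = 1/2"
    then show ?thesis
      using assms(2) * ** Ints_half_integers_disjoint[of "q + 1/2"] Ints_half_integers_disjoint[of q]
      by (auto simp only: int_coset_half half_lattice_eq_Un)
  qed
qed

text \<open>These bounds supply the lower ends of the sums over an odd end: typical values start at
  \<open>\<epsilon>\<close>, atypical ones, once raised by 1/2, start at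
  \<open>1 - \<epsilon>\<close>.\<close>

lemma int_coset_lower_bound:
  assumes "\<epsilon> = 0 \<or> \<epsilon> = 1/2" "q \<in> int_coset \<epsilon>"
  shows "q \<ge> 0 \<longleftrightarrow> q \<ge> \<epsilon>" "q \<ge> 1/2 \<longleftrightarrow> q \<ge> 1 - \<epsilon>"
proof -
  obtain k where k: "q = \<epsilon> + of_int k" using assms by (auto simp: int_coset_def)
  have "of_int k \<le> (-1 :: rat) \<or> of_int k = (0 :: rat) \<or> of_int k \<ge> (1 :: rat)"
  proof -
    have "k \<le> -1 \<or> k = 0 \<or> k \<ge> 1" by linarith
    then show ?thesis by (metis of_int_0 of_int_1 of_int_le_iff of_int_minus)
  qed
  then show "q \<ge> 0 \<longleftrightarrow> q \<ge> \<epsilon>" "q \<ge> 1/2 \<longleftrightarrow> q \<ge> 1 - \<epsilon>"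
    using assms(1) k by linarith+
qed

section \<open>Intervals in a coset and telescoping sums\<close>

definition coset_interval :: "rat \<Rightarrow> rat \<Rightarrow> rat \<Rightarrow> rat set" where
  "coset_interval \<epsilon> a b = {p \<in> int_coset \<epsilon>. a \<le> p \<and> p \<le> b}"

lemma finite_coset_interval [simp]: "finite (coset_interval \<epsilon> a b)"
proof -
  have "coset_interval \<epsilon> a b \<subseteq> (\<lambda>k. \<epsilon> + of_int k) ` {\<lceil>a - \<epsilon>\<rceil>..\<lfloor>b - \<epsilon>\<rfloor>}"
    by (fastforce simp: coset_interval_def int_coset_def ceiling_le_iff le_floor_iff)
  then show ?thesis by (rule finite_subset) simp
qed

text \<open>The case \<open>a = b + 1\<close> is the empty interval, where both sides are 0. It
  occurs for the atypical values of an odd end bounded by 0 when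
  \<open>\<epsilon> = 0\<close>.\<close>

lemma sum_coset_interval_telescope:
  fixes F :: "rat \<Rightarrow> 'b::ab_group_add"
  assumes "a \<in> int_coset \<epsilon>" "b \<in> int_coset \<epsilon>" "a \<le> b + 1"
  shows "(\<Sum>p\<in>coset_interval \<epsilon> a b. F p - F (p - 1)) = F b - F (a - 1)"
proof -
  obtain k where k: "b = a + of_int k" using assms int_coset_diffE by blast
  \<comment> \<open>The number of points of the interval; the induction on it starts at the empty
    one.\<close>
  define m where "m = nat (k + 1)"
  have b: "b = a - 1 + of_nat m"
  proof -
    have "of_int k \<ge> (of_int (-1) :: rat)" using assms k by simp
    then have "k \<ge> -1" by (simp only: of_int_le_iff)
    then have "int m = k + 1" by (simp add: m_def)
    then have "of_nat m = (of_int k + 1 :: rat)"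
      by (metis of_int_1 of_int_add of_int_of_nat_eq)
    then show ?thesis using k by simp
  qed
  have "(\<Sum>p\<in>coset_interval \<epsilon> a (a - 1 + of_nat m). F p - F (p - 1))
        = F (a - 1 + of_nat m) - F (a - 1)"
  proof (induction m)
    case 0
    have "coset_interval \<epsilon> a (a - 1) = {}" by (auto simp: coset_interval_def)
    then show ?case by simp
  next
    case (Suc m)
    let ?I = "\<lambda>m. coset_interval \<epsilon> a (a - 1 + of_nat m)"
    have "?I (Suc m) = insert (a + of_nat m) (?I m)"
    proof (intro equalityI subsetI)
      fix p assume p: "p \<in> ?I (Suc m)"
      then obtain j where j: "p = a + of_int j"
        using assms int_coset_diffE unfolding coset_interval_def by blast
      have "of_int j \<le> (of_int (int m) :: rat)" using p j by (simp add: coset_interval_def)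
      then have "j \<le> int m" by (simp only: of_int_le_iff)
      then consider "j = int m" | "j \<le> int m - 1" by linarith
      then show "p \<in> insert (a + of_nat m) (?I m)"
      proof cases
        case 2
        then have "of_int j \<le> (of_int (int m - 1) :: rat)" by (simp only: of_int_le_iff)
        then show ?thesis using p j by (simp add: coset_interval_def)
      qed (use j in simp)
    next
      fix p assume "p \<in> insert (a + of_nat m) (?I m)"
      then show "p \<in> ?I (Suc m)"
        using assms by (auto simp: coset_interval_def)
    qed
    moreover have "a + of_nat m \<notin> ?I m" by (simp add: coset_interval_def)
    ultimately show ?case using Suc.IH by (simp add: algebra_simps)
  qed
  with b show ?thesis by simp
qed

section \<open>Powers with half-integer exponents\<close>

lemma half_pow_0 [simp]: "half_pow y 0 = 1"
  by (simp add: half_pow_def)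

lemma half_pow_1 [simp]: "half_pow y 1 = y ^ 2"
  by (simp add: half_pow_def power_int_numeral)

lemma half_pow_half [simp]: "half_pow y (1/2) = y"
  by (simp add: half_pow_def)

lemma half_pow_nonzero [simp]: "y \<noteq> 0 \<Longrightarrow> half_pow y e \<noteq> 0"
  by (simp add: half_pow_def)

text \<open>On \<open>half_lattice\<close> the doubled exponents are integers, so the floor in
  \<open>half_pow\<close> loses nothing and exponents add.\<close>

lemma half_pow_add:
  assumes "y \<noteq> 0" "a \<in> half_lattice" "b \<in> half_lattice"
  shows "half_pow y (a + b) = half_pow y a * half_pow y b"
proof -
  obtain k l where "2 * a = of_int k" "2 * b = of_int l"
    using assms by (auto simp: half_lattice_def Ints_def)
  then have "\<lfloor>2 * (a + b)\<rfloor> = \<lfloor>2 * a\<rfloor> + \<lfloor>2 * b\<rfloor>"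
    by (metis distrib_left floor_add_int floor_of_int)
  then show ?thesis
    using assms by (simp add: half_pow_def power_int_add)
qed

lemma half_pow_minus:
  assumes "y \<noteq> 0" "a \<in> half_lattice"
  shows "half_pow y (- a) = inverse (half_pow y a)"
proof -
  have "half_pow y (- a) * half_pow y a = 1"
    using half_pow_add[of y "- a" a] assms by simp
  then show ?thesis by (metis inverse_unique mult.commute)
qed

lemma half_pow_diff:
  assumes "y \<noteq> 0" "a \<in> half_lattice" "b \<in> half_lattice"
  shows "half_pow y (a - b) = half_pow y a / half_pow y b"
  using half_pow_add[of y a "- b"] assms by (simp add: half_pow_minus divide_inverse)

lemma half_pow_sum:
  assumes "y \<noteq> 0" "\<And>i. i \<in> I \<Longrightarrow> f i \<in> half_lattice"
  shows "half_pow y (\<Sum>i\<in>I. f i) = (\<Prod>i\<in>I. half_pow y (f i))"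
  using assms(2)
  by (induction I rule: infinite_finite_induct)
     (auto simp: half_pow_add assms(1) sum_in_half_lattice)


subsection \<open>Determinants\<close>

lemma det_1n_cong:
  "(\<And>i j. i \<in> {1..n} \<Longrightarrow> j \<in> {1..n} \<Longrightarrow> f i j = g i j) \<Longrightarrow> det_1n n f = det_1n n g"
  unfolding det_1n_def by (rule arg_cong[of _ _ det]) (auto intro!: eq_matI)

lemma det_1n_0 [simp]: "det_1n 0 f = 1"
  by (simp add: det_1n_def det_dim_zero)

text \<open>Rows are counted from 1 while permutations act on \<open>{0..<n}\<close>, whence the
  shift in \<open>Suc (p (i - 1))\<close>. The multilinearity lemmas below follow from this form
  term by term.\<close>

lemma det_1n_leibniz:
  "det_1n n f = (\<Sum>p | p permutes {0..<n}. signof p * (\<Prod>i\<in>{1..n}. f i (Suc (p (i - 1)))))"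
proof -
  have "(\<Prod>i\<in>{0..<n}. mat n n (\<lambda>(i, j). f (i + 1) (j + 1)) $$ (i, p i))
      = (\<Prod>i\<in>{1..n}. f i (Suc (p (i - 1))))" if "p permutes {0..<n}" for p
  proof -
    have "(\<Prod>i\<in>{0..<n}. mat n n (\<lambda>(i, j). f (i + 1) (j + 1)) $$ (i, p i))
        = (\<Prod>i\<in>{0..<n}. f (Suc i) (Suc (p i)))"
      using permutes_in_image[OF that] by (intro prod.cong) auto
    also have "\<dots> = (\<Prod>i\<in>{1..n}. f i (Suc (p (i - 1))))"
      by (rule prod.reindex_bij_witness[of _ "\<lambda>i. i - 1" Suc]) auto
    finally show ?thesis .
  qed
  then show ?thesis
    unfolding det_1n_def by (subst det_def'[of _ n]) (auto intro!: sum.cong)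
qed

text \<open>Multilinearity in all rows at once: expanding the product of the row sums yields one
  term per choice function. Since interlacing rows are exactly such choice functions, a sum over
  them becomes a single determinant.\<close>

lemma det_1n_sum_rows:
  assumes "\<And>i. i \<in> {1..n} \<Longrightarrow> finite (S i)"
  shows "det_1n n (\<lambda>i j. \<Sum>k\<in>S i. f i k j) = (\<Sum>g\<in>Pi\<^sub>E {1..n} S. det_1n n (\<lambda>i j. f i (g i) j))"
proof -
  have "(\<Prod>i\<in>{1..n}. \<Sum>k\<in>S i. f i k (Suc (p (i - 1))))
      = (\<Sum>g\<in>Pi\<^sub>E {1..n} S. \<Prod>i\<in>{1..n}. f i (g i) (Suc (p (i - 1))))" for p :: "nat \<Rightarrow> nat"
    by (rule prod_sum_PiE) (use assms in auto)
  then show ?thesis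
    unfolding det_1n_leibniz by (simp add: sum_distrib_left) (rule sum.swap)
qed

lemma det_1n_scale_rows: "det_1n n (\<lambda>i j. r i * f i j) = (\<Prod>i\<in>{1..n}. r i) * det_1n n f"
  by (simp add: det_1n_leibniz prod.distrib sum_distrib_left mult.left_commute)

lemma det_1n_scale_columns: "det_1n n (\<lambda>i j. c j * f i j) = (\<Prod>j\<in>{1..n}. c j) * det_1n n f"
proof -
  have "(\<Prod>i\<in>{1..n}. c (Suc (p (i - 1)))) = (\<Prod>j\<in>{1..n}. c j)" if "p permutes {0..<n}" for p
  proof -
    have "(\<Prod>i\<in>{1..n}. c (Suc (p (i - 1)))) = (\<Prod>i\<in>{0..<n}. c (Suc (p i)))"
      by (rule prod.reindex_bij_witness[of _ Suc "\<lambda>i. i - 1"]) auto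
    also have "\<dots> = (\<Prod>i\<in>{0..<n}. c (Suc i))"
      using prod.permute[OF that, of "\<lambda>i. c (Suc i)"] by (simp add: o_def)
    also have "\<dots> = (\<Prod>j\<in>{1..n}. c j)"
      by (rule prod.reindex_bij_witness[of _ "\<lambda>i. i - 1" Suc]) auto
    finally show ?thesis .
  qed
  then show ?thesis
    by (simp add: det_1n_leibniz prod.distrib sum_distrib_left mult.left_commute)
qed

text \<open>Telescoped sums leave differences of consecutive rows, which this removes.\<close>

lemma det_1n_row_differences:
  "det_1n n (\<lambda>i j. if i < n then f i j - f (Suc i) j else f i j) = det_1n n f"
proof -
  \<comment> \<open>Upper bidiagonal and unipotent: multiplication by \<open>U\<close> from the left
    subtracts from each row its successor and keeps the last row.\<close>
  define U where "U = mat n n (\<lambda>(i, j). if j = i then 1 else if j = Suc i then - 1 else 0 :: 'a)"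
  define F where "F = mat n n (\<lambda>(i, j). f (i + 1) (j + 1))"
  have U: "U \<in> carrier_mat n n" and F: "F \<in> carrier_mat n n"
    by (simp_all add: U_def F_def)
  have "det U = prod_list (diag_mat U)"
    by (rule det_upper_triangular[OF _ U]) (auto simp: U_def)
  also have "\<dots> = 1"
    by (subst prod_list_diag_prod) (simp add: U_def)
  finally have "det U = 1" .
  moreover have "mat n n (\<lambda>(i, j). if i + 1 < n then f (i + 1) (j + 1) - f (Suc (i + 1)) (j + 1)
      else f (i + 1) (j + 1)) = U * F"
  proof (rule eq_matI; simp add: U_def F_def scalar_prod_def, goal_cases)
    case (1 i j)
    have "(\<Sum>k = 0..<n. (if k = i then 1 else if k = Suc i then - 1 else 0) * f (Suc k) (Suc j))
        = (\<Sum>k = 0..<n. (if k = i then f (Suc k) (Suc j) else 0)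
             + (if k = Suc i then - f (Suc k) (Suc j) else 0))"
      by (rule sum.cong) auto
    also have "\<dots> = (if i + 1 < n then f (i + 1) (j + 1) - f (Suc (i + 1)) (j + 1)
        else f (i + 1) (j + 1))"
      using 1 by (simp add: sum.distrib sum.delta)
    finally show ?case using 1 by (simp add: split: if_splits)
  qed
  ultimately show ?thesis
    using det_mult[OF U F] by (simp add: det_1n_def F_def if_distrib cong: if_cong)
qed

text \<open>Read from right to left, this borders a determinant to the next size. Row differences
  turn a column of ones into exactly such a unit column.\<close>

lemma det_1n_last_column_unit:
  assumes "\<And>i. i \<in> {1..n} \<Longrightarrow> f i (Suc n) = 0" "f (Suc n) (Suc n) = 1"
  shows "det_1n (Suc n) f = det_1n n f"
proof -
  define A where "A = mat (Suc n) (Suc n) (\<lambda>(i, j). f (i + 1) (j + 1))"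
  have "det A = (\<Sum>i<Suc n. A $$ (i, n) * cofactor A i n)"
    by (rule laplace_expansion_column) (auto simp: A_def)
  also have "\<dots> = cofactor A n n"
    using assms by (simp add: A_def)
  also have "\<dots> = det (mat_delete A n n)"
    by (simp add: cofactor_def)
  also have "mat_delete A n n = mat n n (\<lambda>(i, j). f (i + 1) (j + 1))"
    by (rule eq_matI) (auto simp: mat_delete_def A_def)
  finally show ?thesis by (simp add: det_1n_def A_def)
qed

subsection \<open>Removing the last two rows of a pattern\<close>

definition coset_partition :: "rat \<Rightarrow> nat \<Rightarrow> (nat \<Rightarrow> rat) \<Rightarrow> bool" where
  "coset_partition \<epsilon> n lam \<longleftrightarrow>
     (\<forall>i\<in>{1..n}. lam i \<in> int_coset \<epsilon> \<and> lam i \<ge> 0) \<and>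
     (\<forall>i\<in>{1..n}. \<forall>j\<in>{1..n}. i \<le> j \<longrightarrow> lam i \<ge> lam j)"

lemma coset_partition_0: "coset_partition 0 n lam \<longleftrightarrow> is_partition n lam"
  by (simp add: coset_partition_def is_partition_def int_coset_0)

lemma coset_partition_half: "coset_partition (1/2) n lam \<longleftrightarrow> is_half_partition n lam"
  by (simp only: coset_partition_def is_half_partition_def int_coset_half)

lemma coset_partitionD:
  assumes "coset_partition \<epsilon> n lam" "i \<in> {1..n}"
  shows "lam i \<in> int_coset \<epsilon>" "lam i \<ge> 0" "Suc i \<le> n \<Longrightarrow> lam (Suc i) \<le> lam i"
  using assms by (auto simp: coset_partition_def)

lemma coset_partition_in_coset:
  "coset_partition \<epsilon> n lam \<Longrightarrow> \<forall>i\<in>{1..n}. lam i \<in> int_coset \<epsilon>"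
  by (simp add: coset_partition_def)

lemma coset_partitionI:
  assumes "\<And>i. i \<in> {1..n} \<Longrightarrow> lam i \<in> int_coset \<epsilon> \<and> lam i \<ge> 0"
    and step: "\<And>i. i \<in> {1..n} \<Longrightarrow> Suc i \<le> n \<Longrightarrow> lam (Suc i) \<le> lam i"
  shows "coset_partition \<epsilon> n lam"
proof -
  have "lam j \<le> lam i" if "1 \<le> i" "i \<le> j" "j \<le> n" for i j
    using that(2,3)
  proof (induction j rule: dec_induct)
    case (step k)
    then show ?case using assms(2)[of k] that(1) by simp
  qed simp
  then show ?thesis using assms(1) by (auto simp: coset_partition_def)
qed

section \<open>Index sets, and patterns with a shape in a given coset\<close>

lemma array_indices_0 [simp]: "array_indices 0 = {}"
  by (auto simp: array_indices_def)

lemma array_indices_Suc: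
  "array_indices (Suc n) =
     array_indices n \<union> {2 * n + 1} \<times> {1..n + 1} \<union> {2 * n + 2} \<times> {1..n + 1}"
  by (auto simp: array_indices_def le_Suc_eq)

lemma odd_ends_0 [simp]: "odd_ends 0 = {}"
  by (auto simp: odd_ends_def)

lemma odd_ends_Suc: "odd_ends (Suc n) = insert (2 * n + 1, n + 1) (odd_ends n)"
  by (auto simp: odd_ends_def le_Suc_eq)

lemma odd_ends_subset: "odd_ends n \<subseteq> array_indices n"
  by (auto simp: odd_ends_def array_indices_def)

lemma finite_odd_ends: "finite (odd_ends n)"
  by (induction n) (auto simp: odd_ends_Suc)

lemma row_notin_array_indices:
  "i > 2 * n \<Longrightarrow> (i, j) \<notin> array_indices n" "i > 2 * n \<Longrightarrow> (i, j) \<notin> odd_ends n"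
  by (auto simp: array_indices_def odd_ends_def)

lemma last_row_in_array_indices: "j \<in> {1..n} \<Longrightarrow> (2 * n, j) \<in> array_indices n - odd_ends n"
  by (auto simp: array_indices_def odd_ends_def)

text \<open>The entry \<open>z (2 * n, 1)\<close> is not an odd end and equals \<open>lam 1\<close>,
  so the coset of the shape decides the alternative in \<open>so_patterns_def\<close>. For
  \<open>n = 0\<close> there is no entry to consider.\<close>

lemma so_patterns_iff:
  assumes "\<epsilon> = 0 \<or> \<epsilon> = 1/2" "\<forall>i\<in>{1..n}. lam i \<in> int_coset \<epsilon>"
  shows "z \<in> so_patterns n lam \<longleftrightarrow>
     (\<forall>p. p \<notin> array_indices n \<longrightarrow> z p = 0) \<and> interlacing n z \<and>
     (\<forall>p\<in>odd_ends n. z p \<in> half_lattice \<and> z p \<ge> 0) \<and>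
     (\<forall>p\<in>array_indices n - odd_ends n. z p \<in> int_coset \<epsilon> \<and> z p \<ge> 0) \<and>
     (\<forall>j\<in>{1..n}. z (2 * n, j) = lam j)"
proof (cases "n = 0")
  case True
  then show ?thesis by (simp add: so_patterns_def)
next
  case False
  then have p: "(2 * n, 1) \<in> array_indices n - odd_ends n" and 1: "1 \<in> {1..n}"
    using last_row_in_array_indices[of 1 n] by auto
  let ?A = "array_indices n - odd_ends n"
  have "((\<forall>p\<in>?A. z p \<in> \<int> \<and> z p \<ge> 0) \<or> (\<forall>p\<in>?A. z p \<in> half_integers \<and> z p \<ge> 0))
      \<longleftrightarrow> (\<forall>p\<in>?A. z p \<in> int_coset \<epsilon> \<and> z p \<ge> 0)"
    if "\<forall>j\<in>{1..n}. z (2 * n, j) = lam j"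
  proof -
    have z1: "z (2 * n, 1) \<in> int_coset \<epsilon>" using that 1 assms(2) by metis
    from assms(1) show ?thesis
    proof
      assume e: "\<epsilon> = 0"
      have "z (2 * n, 1) \<notin> half_integers"
        using z1 Ints_half_integers_disjoint unfolding e int_coset_0 by blast
      then show ?thesis using p unfolding e int_coset_0 by blast
    next
      assume e: "\<epsilon> = 1/2"
      have "z (2 * n, 1) \<notin> \<int>"
        using z1 Ints_half_integers_disjoint unfolding e int_coset_half by blast
      then show ?thesis using p unfolding e int_coset_half by blast
    qed
  qed
  then show ?thesis
    unfolding so_patterns_def half_lattice_eq_Un by blast
qed

lemma so_patternsD:
  assumes "\<epsilon> = 0 \<or> \<epsilon> = 1/2" "\<forall>i\<in>{1..n}. lam i \<in> int_coset \<epsilon>" "z \<in> so_patterns n lam"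
  shows "p \<notin> array_indices n \<Longrightarrow> z p = 0" "interlacing n z"
    "p \<in> odd_ends n \<Longrightarrow> z p \<in> half_lattice \<and> z p \<ge> 0"
    "p \<in> array_indices n - odd_ends n \<Longrightarrow> z p \<in> int_coset \<epsilon> \<and> z p \<ge> 0"
    "j \<in> {1..n} \<Longrightarrow> z (2 * n, j) = lam j"
  using iffD1[OF so_patterns_iff[OF assms(1,2)] assms(3)] by blast+

text \<open>All entries other than odd ends lie in the coset of the shape, and the two cosets are
  disjoint, so being atypical means being an odd end outside that coset.\<close>

lemma atypical_eq:
  assumes "\<epsilon> = 0 \<or> \<epsilon> = 1/2" "\<forall>i\<in>{1..n}. lam i \<in> int_coset \<epsilon>" "z \<in> so_patterns n lam"
  shows "atypical n z = {p \<in> odd_ends n. z p \<notin> int_coset \<epsilon>}"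
proof (cases "n = 0")
  case True
  then show ?thesis by (simp add: atypical_def)
next
  case False
  note z = so_patternsD[OF assms]
  have z1: "z (2 * n, 1) \<in> int_coset \<epsilon>"
    using False assms(2) z(5) by auto
  have ends: "z p \<in> \<int> \<or> z p \<in> half_integers" if "p \<in> odd_ends n" for p
    using z(3)[OF that] unfolding half_lattice_eq_Un by blast
  have inner: "z p \<in> int_coset \<epsilon>" if "p \<in> array_indices n" "p \<notin> odd_ends n" for p
    using z(4) that by blast
  note facts = ends inner odd_ends_subset[of n] Ints_half_integers_disjoint
  from assms(1) show ?thesis
  proof
    assume e: "\<epsilon> = 0"
    have "z (2 * n, 1) \<in> \<int>" using z1 unfolding e int_coset_0 .
    then have "atypical n z = {p \<in> array_indices n. z p \<in> half_integers}"
      by (simp add: atypical_def)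
    also have "\<dots> = {p \<in> odd_ends n. z p \<notin> int_coset \<epsilon>}"
      using facts unfolding e int_coset_0 by blast
    finally show ?thesis .
  next
    assume e: "\<epsilon> = 1/2"
    have "z (2 * n, 1) \<notin> \<int>"
      using z1 Ints_half_integers_disjoint unfolding e int_coset_half by blast
    then have "atypical n z = {p \<in> array_indices n. z p \<in> \<int>}"
      by (simp add: atypical_def)
    also have "\<dots> = {p \<in> odd_ends n. z p \<notin> int_coset \<epsilon>}"
      using facts unfolding e int_coset_half by blast
    finally show ?thesis .
  qed
qed

lemma interlacing_cong:
  "(\<And>p. p \<in> array_indices n \<Longrightarrow> z p = z' p) \<Longrightarrow> interlacing n z \<longleftrightarrow> interlacing n z'"
  unfolding interlacing_def by (intro iff_allI) auto

lemma interlacing_Suc: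
  "interlacing (Suc n) z \<longleftrightarrow> interlacing n z \<and>
     (\<forall>j\<in>{1..n}. z (2 * n + 1, Suc j) \<le> z (2 * n, j) \<and> z (2 * n, j) \<le> z (2 * n + 1, j)) \<and>
     (\<forall>j\<in>{1..n}. z (2 * n + 2, Suc j) \<le> z (2 * n + 1, j)) \<and>
     (\<forall>j\<in>{1..Suc n}. z (2 * n + 1, j) \<le> z (2 * n + 2, j))"
  (is "?L \<longleftrightarrow> ?R")
proof
  assume L: ?L
  have "interlacing n z"
    using L unfolding interlacing_def array_indices_Suc by blast
  moreover have "z (2 * n + 1, Suc j) \<le> z (2 * n, j) \<and> z (2 * n, j) \<le> z (2 * n + 1, j)"
    if "j \<in> {1..n}" for j
    using L that unfolding interlacing_def
    by (auto simp: array_indices_def dest!: spec[of _ "2 * n"] spec[of _ j])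
  moreover have "z (2 * n + 2, Suc j) \<le> z (2 * n + 1, j)" if "j \<in> {1..n}" for j
    using L that unfolding interlacing_def
    by (auto simp: array_indices_def dest!: spec[of _ "2 * n + 1"] spec[of _ j])
  moreover have "z (2 * n + 1, j) \<le> z (2 * n + 2, j)" if "j \<in> {1..Suc n}" for j
    using L that unfolding interlacing_def
    by (auto simp: array_indices_def dest!: spec[of _ "2 * n + 1"] spec[of _ j])
  ultimately show ?R by blast
next
  assume R: ?R
  show ?L
    unfolding interlacing_def
  proof (intro allI impI)
    fix i j assume ij: "(i, j) \<in> array_indices (Suc n)"
    then consider "i < 2 * n" | "i = 2 * n" | "i = 2 * n + 1" | "i = 2 * n + 2"
      by (force simp: array_indices_def)
    then show "((i + 1, j + 1) \<in> array_indices (Suc n) \<longrightarrow> z (i + 1, j + 1) \<le> z (i, j)) \<and>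
        ((i + 1, j) \<in> array_indices (Suc n) \<longrightarrow> z (i, j) \<le> z (i + 1, j))"
    proof cases
      case 1
      then have "(i, j) \<in> array_indices n"
        "(i + 1, j) \<in> array_indices (Suc n) \<longleftrightarrow> (i + 1, j) \<in> array_indices n"
        "(i + 1, j + 1) \<in> array_indices (Suc n) \<longleftrightarrow> (i + 1, j + 1) \<in> array_indices n"
        using ij by (auto simp: array_indices_def)
      then show ?thesis using R unfolding interlacing_def by auto
    next
      case 2
      then have "j \<in> {1..n}" using ij by (auto simp: array_indices_def)
      then show ?thesis using R 2 by simp
    next
      case 3
      then have j: "j \<in> {1..Suc n}" using ij by (auto simp: array_indices_def)
      show ?thesis
      \<comment> \<open>Rows \<open>2 * n + 1\<close> and \<open>2 * n + 2\<close> have the same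
        length, so the odd end \<open>j = Suc n\<close> has no neighbour
        \<open>(2 * n + 2, n + 2)\<close> and is only bounded from above.\<close>
      proof (cases "j = Suc n")
        case True
        then show ?thesis using R 3 by (auto simp: array_indices_def)
      next
        case False
        then have "j \<in> {1..n}" using j by auto
        then show ?thesis using R 3 j by simp
      qed
    next
      case 4
      then show ?thesis by (auto simp: array_indices_def)
    qed
  qed
qed

text \<open>The candidates for row \<open>2 * n + 1\<close> when row \<open>2 * n + 2\<close> is
  \<open>lam\<close>. The last coordinate is the odd end: row \<open>2 * n + 2\<close> gives it no
  lower bound, so nonnegativity does, and it may lie in either coset. The coordinates range
  independently, as \<open>det_1n_sum_rows\<close> requires.\<close>

definition upper_rows :: "rat \<Rightarrow> nat \<Rightarrow> (nat \<Rightarrow> rat) \<Rightarrow> (nat \<Rightarrow> rat) set" where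
  "upper_rows \<epsilon> n lam = Pi\<^sub>E {1..Suc n} (\<lambda>i. if i = Suc n then {p \<in> half_lattice. 0 \<le> p \<and> p \<le> lam i}
      else coset_interval \<epsilon> (lam (Suc i)) (lam i))"

text \<open>The candidates for row \<open>2 * n\<close> when row \<open>2 * n + 1\<close> is
  \<open>nu\<close>. All its entries are in the coset, even if the bound \<open>nu (Suc n)\<close>
  is not.\<close>

definition lower_rows :: "rat \<Rightarrow> nat \<Rightarrow> (nat \<Rightarrow> rat) \<Rightarrow> (nat \<Rightarrow> rat) set" where
  "lower_rows \<epsilon> n nu = Pi\<^sub>E {1..n} (\<lambda>i. coset_interval \<epsilon> (nu (Suc i)) (nu i))"

lemma upper_rowsD:
  assumes "nu \<in> upper_rows \<epsilon> n lam"
  shows "nu (Suc n) \<in> half_lattice" "0 \<le> nu (Suc n)" "nu (Suc n) \<le> lam (Suc n)"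
    "i \<in> {1..n} \<Longrightarrow> nu i \<in> int_coset \<epsilon>" "i \<in> {1..n} \<Longrightarrow> lam (Suc i) \<le> nu i"
    "i \<in> {1..n} \<Longrightarrow> nu i \<le> lam i"
proof -
  note mem = PiE_mem[OF assms[unfolded upper_rows_def]]
  show "nu (Suc n) \<in> half_lattice" "0 \<le> nu (Suc n)" "nu (Suc n) \<le> lam (Suc n)"
    using mem[of "Suc n"] by auto
  assume "i \<in> {1..n}"
  then show "nu i \<in> int_coset \<epsilon>" "lam (Suc i) \<le> nu i" "nu i \<le> lam i"
    using mem[of i] by (auto simp: coset_interval_def)
qed

lemma lower_rowsD:
  assumes "mu \<in> lower_rows \<epsilon> n nu" "i \<in> {1..n}"
  shows "mu i \<in> int_coset \<epsilon>" "nu (Suc i) \<le> mu i" "mu i \<le> nu i"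
  using PiE_mem[OF assms[unfolded lower_rows_def]] by (auto simp: coset_interval_def)

lemma lower_rows_in_coset:
  "mu \<in> lower_rows \<epsilon> n nu \<Longrightarrow> \<forall>i\<in>{1..n}. mu i \<in> int_coset \<epsilon>"
  using lower_rowsD(1) by blast

section \<open>Gluing two rows to a smaller pattern\<close>

lemma upper_rows_nonneg:
  assumes "coset_partition \<epsilon> (Suc n) lam" "nu \<in> upper_rows \<epsilon> n lam" "i \<in> {1..Suc n}"
  shows "nu i \<ge> 0"
  using upper_rowsD(2)[OF assms(2)] upper_rowsD(5)[OF assms(2), of i] assms(3)
    coset_partitionD(2)[OF assms(1), of "Suc i"]
  by (cases "i = Suc n") auto

text \<open>Consecutive entries of \<open>mu\<close> are separated by an entry of \<open>nu\<close>,
  so \<open>mu\<close> is again an admissible shape for the induction.\<close>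

lemma lower_rows_coset_partition:
  assumes "coset_partition \<epsilon> (Suc n) lam" "nu \<in> upper_rows \<epsilon> n lam" "mu \<in> lower_rows \<epsilon> n nu"
  shows "coset_partition \<epsilon> n mu"
proof (rule coset_partitionI)
  fix i assume i: "i \<in> {1..n}"
  have "0 \<le> nu (Suc i)" using upper_rows_nonneg[OF assms(1,2), of "Suc i"] i by simp
  then show "mu i \<in> int_coset \<epsilon> \<and> mu i \<ge> 0" using lower_rowsD[OF assms(3) i] by auto
  show "mu (Suc i) \<le> mu i" if "Suc i \<le> n"
    using lower_rowsD(2)[OF assms(3) i] lower_rowsD(3)[OF assms(3), of "Suc i"] that i by auto
qed

text \<open>Outside the two new rows the values of \<open>z\<close> are kept, so the convention of
  being 0 off the index set is inherited.\<close>

definition append_rows ::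
    "nat \<Rightarrow> (nat \<Rightarrow> rat) \<Rightarrow> (nat \<Rightarrow> rat) \<Rightarrow> (nat \<times> nat \<Rightarrow> rat) \<Rightarrow> nat \<times> nat \<Rightarrow> rat" where
  "append_rows n lam nu z = (\<lambda>(i, j).
     if i = 2 * n + 2 \<and> j \<in> {1..n + 1} then lam j
     else if i = 2 * n + 1 \<and> j \<in> {1..n + 1} then nu j else z (i, j))"

lemma append_rows_simps:
  "j \<in> {1..n + 1} \<Longrightarrow> append_rows n lam nu z (2 * n + 2, j) = lam j"
  "j \<in> {1..n + 1} \<Longrightarrow> append_rows n lam nu z (2 * n + 1, j) = nu j"
  "i \<le> 2 * n \<Longrightarrow> append_rows n lam nu z (i, j) = z (i, j)"
  "p \<in> array_indices n \<Longrightarrow> append_rows n lam nu z p = z p"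
  by (auto simp: append_rows_def array_indices_def)

lemma append_rows_in_so_patterns:
  assumes \<epsilon>: "\<epsilon> = 0 \<or> \<epsilon> = 1/2" and lam: "coset_partition \<epsilon> (Suc n) lam"
    and nu: "nu \<in> upper_rows \<epsilon> n lam" and mu: "mu \<in> lower_rows \<epsilon> n nu"
    and z: "z \<in> so_patterns n mu"
  shows "append_rows n lam nu z \<in> so_patterns (Suc n) lam"
proof -
  let ?w = "append_rows n lam nu z"
  note z' = so_patternsD[OF \<epsilon> lower_rows_in_coset[OF mu] z]
  have w: "?w (2 * n + 2, j) = lam j" "?w (2 * n + 1, j) = nu j" if "j \<in> {1..Suc n}" for j
    using that append_rows_simps(1,2)[of j n lam nu z] by simp_all
  have "interlacing (Suc n) ?w"
  proof -
    have "interlacing n ?w"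
      using z'(2) by (subst interlacing_cong[of n _ z]) (auto simp: append_rows_simps(4))
    then show ?thesis
      unfolding interlacing_Suc
    proof (intro conjI ballI)
      fix j assume j: "j \<in> {1..n}"
      then have j': "j \<in> {1..Suc n}" "Suc j \<in> {1..Suc n}" by auto
      have "?w (2 * n, j) = mu j" using z'(5)[OF j] by (simp add: append_rows_simps(3))
      then show "?w (2 * n + 1, Suc j) \<le> ?w (2 * n, j)" "?w (2 * n, j) \<le> ?w (2 * n + 1, j)"
        using lower_rowsD[OF mu j] by (simp_all only: w(2)[OF j'(1)] w(2)[OF j'(2)])
      show "?w (2 * n + 2, Suc j) \<le> ?w (2 * n + 1, j)"
        using upper_rowsD(5)[OF nu j] by (simp only: w(1)[OF j'(2)] w(2)[OF j'(1)])
    next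
      fix j assume j: "j \<in> {1..Suc n}"
      then have "nu j \<le> lam j"
        using upper_rowsD(3)[OF nu] upper_rowsD(6)[OF nu, of j] by (cases "j = Suc n") auto
      then show "?w (2 * n + 1, j) \<le> ?w (2 * n + 2, j)" by (simp only: w[OF j])
    qed
  qed
  moreover have "?w p = 0" if "p \<notin> array_indices (Suc n)" for p
    using that z'(1)[of p] by (cases p) (auto simp: append_rows_def array_indices_Suc)
  moreover have "?w p \<in> half_lattice \<and> ?w p \<ge> 0" if "p \<in> odd_ends (Suc n)" for p
    using that w[of "Suc n"] upper_rowsD[OF nu] z'(3)[of p] odd_ends_subset[of n]
    by (auto simp: odd_ends_Suc append_rows_simps(4))
  moreover have "?w p \<in> int_coset \<epsilon> \<and> ?w p \<ge> 0" if p: "p \<in> array_indices (Suc n) - odd_ends (Suc n)" for p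
  proof -
    from p consider "p \<in> array_indices n - odd_ends n"
      | j where "j \<in> {1..n}" "p = (2 * n + 1, j)" | j where "j \<in> {1..Suc n}" "p = (2 * n + 2, j)"
      by (auto simp: array_indices_Suc odd_ends_Suc le_Suc_eq)
    then show ?thesis
    proof cases
      case 1
      then show ?thesis using z'(4) by (auto simp: append_rows_simps(4))
    next
      case (2 j)
      then show ?thesis
        using w(2)[of j] upper_rowsD(4)[OF nu, of j] upper_rows_nonneg[OF lam nu, of j] by simp
    next
      case (3 j)
      then show ?thesis using w(1)[of j] coset_partitionD[OF lam, of j] by simp
    qed
  qed
  ultimately show ?thesis
    using w(1) by (simp add: so_patterns_iff[OF \<epsilon> coset_partition_in_coset[OF lam]])
qed

lemma so_patterns_SucE:
  assumes \<epsilon>: "\<epsilon> = 0 \<or> \<epsilon> = 1/2" and lam: "coset_partition \<epsilon> (Suc n) lam"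
    and w: "w \<in> so_patterns (Suc n) lam"
  obtains nu mu z where "nu \<in> upper_rows \<epsilon> n lam" "mu \<in> lower_rows \<epsilon> n nu" "z \<in> so_patterns n mu"
    "w = append_rows n lam nu z"
proof -
  \<comment> \<open>Restriction makes the rows extensional, hence members of the \<open>PiE\<close>
    sets and uniquely determined by \<open>w\<close>.\<close>
  define nu where "nu = restrict (\<lambda>j. w (2 * n + 1, j)) {1..Suc n}"
  define mu where "mu = restrict (\<lambda>j. w (2 * n, j)) {1..n}"
  define z where "z = (\<lambda>p. if p \<in> array_indices n then w p else 0)"
  note w' = so_patternsD[OF \<epsilon> coset_partition_in_coset[OF lam] w]
  have w5: "w (2 * n + 2, j) = lam j" if "j \<in> {1..Suc n}" for j
    using w'(5)[OF that] by simp
  have i: "interlacing n w"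
    "\<And>j. j \<in> {1..n} \<Longrightarrow> w (2 * n + 1, Suc j) \<le> w (2 * n, j)"
    "\<And>j. j \<in> {1..n} \<Longrightarrow> w (2 * n, j) \<le> w (2 * n + 1, j)"
    "\<And>j. j \<in> {1..n} \<Longrightarrow> w (2 * n + 2, Suc j) \<le> w (2 * n + 1, j)"
    "\<And>j. j \<in> {1..Suc n} \<Longrightarrow> w (2 * n + 1, j) \<le> w (2 * n + 2, j)"
    using w'(2) unfolding interlacing_Suc by blast+
  have c1: "w (2 * n + 1, j) \<in> int_coset \<epsilon>" if "j \<in> {1..n}" for j
    using that w'(4)[of "(2 * n + 1, j)"]
    by (auto simp: array_indices_Suc odd_ends_Suc row_notin_array_indices)
  have c2: "w (2 * n, j) \<in> int_coset \<epsilon>" if "j \<in> {1..n}" for j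
    using that w'(4)[of "(2 * n, j)"] last_row_in_array_indices[OF that]
    by (auto simp: array_indices_Suc odd_ends_Suc)
  have "nu j \<in> coset_interval \<epsilon> (lam (Suc j)) (lam j)" if "j \<in> {1..n}" for j
    using that i(4)[OF that] i(5)[of j] c1[OF that] w5[of j] w5[of "Suc j"]
    by (auto simp: nu_def coset_interval_def)
  moreover have "nu (Suc n) \<in> {p \<in> half_lattice. 0 \<le> p \<and> p \<le> lam (Suc n)}"
    using i(5)[of "Suc n"] w'(3)[of "(2 * n + 1, n + 1)"] w5[of "Suc n"] by (auto simp: nu_def odd_ends_Suc)
  ultimately have "nu j \<in> (if j = Suc n then {p \<in> half_lattice. 0 \<le> p \<and> p \<le> lam j}
      else coset_interval \<epsilon> (lam (Suc j)) (lam j))" if "j \<in> {1..Suc n}" for j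
    using that by (cases "j = Suc n") auto
  then have "nu \<in> upper_rows \<epsilon> n lam"
    unfolding upper_rows_def by (intro PiE_I) (auto simp: nu_def)
  moreover have "mu j \<in> coset_interval \<epsilon> (nu (Suc j)) (nu j)" if "j \<in> {1..n}" for j
    using that i(2,3)[OF that] c2[OF that] by (auto simp: mu_def nu_def coset_interval_def)
  then have "mu \<in> lower_rows \<epsilon> n nu"
    unfolding lower_rows_def by (auto simp: mu_def)
  moreover have "z \<in> so_patterns n mu"
  proof -
    have "interlacing n z"
      using i by (subst interlacing_cong[of n _ w]) (auto simp: z_def)
    moreover have "z p \<in> half_lattice \<and> z p \<ge> 0" if "p \<in> odd_ends n" for p
      using that w'(3)[of p] odd_ends_subset[of n] by (auto simp: z_def odd_ends_Suc)
    moreover have "z p \<in> int_coset \<epsilon> \<and> z p \<ge> 0" if "p \<in> array_indices n - odd_ends n" for p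
      using that w'(4)[of p] row_notin_array_indices[of n "2 * n + 1"]
      by (auto simp: z_def array_indices_Suc odd_ends_Suc)
    moreover have "z (2 * n, j) = mu j" if "j \<in> {1..n}" for j
      using that last_row_in_array_indices[OF that] by (auto simp: z_def mu_def)
    ultimately show ?thesis
      using c2 by (subst so_patterns_iff[OF \<epsilon>]) (auto simp: mu_def z_def)
  qed
  moreover have "w = append_rows n lam nu z"
  proof
    fix p :: "nat \<times> nat"
    obtain i j where p: "p = (i, j)" by fastforce
    show "w p = append_rows n lam nu z p"
      using w'(1)[of p] w5[of j]
      by (auto simp: p append_rows_def z_def nu_def array_indices_Suc row_notin_array_indices)
  qed
  ultimately show ?thesis by (rule that)
qed

text \<open>The row \<open>nu\<close> can be read off, \<open>z\<close> is the rest of the array,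
  and \<open>mu\<close> is the shape of \<open>z\<close>; extensionality fixes the rows outside
  their index ranges.\<close>

lemma append_rows_inj:
  assumes nu: "nu \<in> upper_rows \<epsilon> n lam" "nu' \<in> upper_rows \<epsilon> n lam"
    and mu: "mu \<in> lower_rows \<epsilon> n nu" "mu' \<in> lower_rows \<epsilon> n nu'"
    and z: "z \<in> so_patterns n mu" "z' \<in> so_patterns n mu'"
    and eq: "append_rows n lam nu z = append_rows n lam nu' z'"
  shows "nu = nu'" "mu = mu'" "z = z'"
proof -
  show "nu = nu'"
  proof (rule PiE_ext[OF nu[unfolded upper_rows_def]])
    fix j assume "j \<in> {1..Suc n}"
    then show "nu j = nu' j"
      using append_rows_simps(2)[of j n lam nu z] append_rows_simps(2)[of j n lam nu' z'] eq by simp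
  qed
  show "z = z'"
  proof
    fix p
    show "z p = z' p"
    proof (cases "p \<in> array_indices n")
      case True
      then show ?thesis
        using append_rows_simps(4)[of p n lam nu z] append_rows_simps(4)[of p n lam nu' z'] eq by simp
    next
      case False
      then have "z p = 0" "z' p = 0" using z by (auto simp only: so_patterns_def)
      then show ?thesis by simp
    qed
  qed
  show "mu = mu'"
  proof (rule ext)
    fix j
    show "mu j = mu' j"
    proof (cases "j \<in> {1..n}")
      case True
      then show ?thesis using z \<open>z = z'\<close> by (auto simp: so_patterns_def)
    next
      case False
      then show ?thesis using mu unfolding lower_rows_def by (metis PiE_arb)
    qed
  qed
qed

lemma bij_betw_append_rows:
  assumes "\<epsilon> = 0 \<or> \<epsilon> = 1/2" "coset_partition \<epsilon> (Suc n) lam"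
  shows "bij_betw (\<lambda>(nu, mu, z). append_rows n lam nu z)
     (SIGMA nu:upper_rows \<epsilon> n lam. SIGMA mu:lower_rows \<epsilon> n nu. so_patterns n mu)
     (so_patterns (Suc n) lam)"
  unfolding bij_betw_def
proof
  show "inj_on (\<lambda>(nu, mu, z). append_rows n lam nu z)
     (SIGMA nu:upper_rows \<epsilon> n lam. SIGMA mu:lower_rows \<epsilon> n nu. so_patterns n mu)"
  proof (rule inj_onI)
    fix p p'
    assume p: "p \<in> (SIGMA nu:upper_rows \<epsilon> n lam. SIGMA mu:lower_rows \<epsilon> n nu. so_patterns n mu)"
      and p': "p' \<in> (SIGMA nu:upper_rows \<epsilon> n lam. SIGMA mu:lower_rows \<epsilon> n nu. so_patterns n mu)"
      and eq: "(\<lambda>(nu, mu, z). append_rows n lam nu z) p = (\<lambda>(nu, mu, z). append_rows n lam nu z) p'"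
    obtain nu mu z nu' mu' z' where pp: "p = (nu, mu, z)" "p' = (nu', mu', z')"
      by (metis prod.exhaust)
    show "p = p'"
      using append_rows_inj[of nu \<epsilon> n lam nu' mu mu' z z'] p p' eq by (simp add: pp)
  qed
  show "(\<lambda>(nu, mu, z). append_rows n lam nu z) `
     (SIGMA nu:upper_rows \<epsilon> n lam. SIGMA mu:lower_rows \<epsilon> n nu. so_patterns n mu)
     = so_patterns (Suc n) lam"
  proof (intro equalityI subsetI)
    fix w assume "w \<in> so_patterns (Suc n) lam"
    then obtain nu mu z where "nu \<in> upper_rows \<epsilon> n lam" "mu \<in> lower_rows \<epsilon> n nu" "z \<in> so_patterns n mu"
      "w = append_rows n lam nu z"
      using so_patterns_SucE assms by metis
    then show "w \<in> (\<lambda>(nu, mu, z). append_rows n lam nu z) `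
     (SIGMA nu:upper_rows \<epsilon> n lam. SIGMA mu:lower_rows \<epsilon> n nu. so_patterns n mu)"
      by (intro image_eqI[of _ _ "(nu, mu, z)"]) auto
  qed (use append_rows_in_so_patterns[OF assms] in auto)
qed

lemma finite_half_lattice_interval [simp]: "finite {p \<in> half_lattice. a \<le> p \<and> p \<le> b}"
proof -
  have "{p \<in> half_lattice. a \<le> p \<and> p \<le> b} = coset_interval 0 a b \<union> coset_interval (1/2) a b"
    unfolding coset_interval_def int_coset_half int_coset_0 half_lattice_eq_Un by blast
  then show ?thesis by simp
qed

lemma finite_upper_rows [simp]: "finite (upper_rows \<epsilon> n lam)"
  unfolding upper_rows_def by (intro finite_PiE) auto

lemma finite_lower_rows [simp]: "finite (lower_rows \<epsilon> n nu)"
  unfolding lower_rows_def by (intro finite_PiE) auto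

lemma so_patterns_0: "so_patterns 0 lam = {\<lambda>_. 0}"
  by (auto simp: so_patterns_def interlacing_def)

lemma finite_so_patterns:
  assumes "\<epsilon> = 0 \<or> \<epsilon> = 1/2" "coset_partition \<epsilon> n lam"
  shows "finite (so_patterns n lam)"
  using assms(2)
proof (induction n arbitrary: lam)
  case 0
  show ?case by (simp add: so_patterns_0)
next
  case (Suc n)
  have "finite (SIGMA nu:upper_rows \<epsilon> n lam. SIGMA mu:lower_rows \<epsilon> n nu. so_patterns n mu)"
    using Suc.IH lower_rows_coset_partition[OF Suc.prems] by (intro finite_SigmaI) auto
  then show ?case
    using bij_betw_finite[OF bij_betw_append_rows[OF assms(1) Suc.prems]] by simp
qed

section \<open>Weights, and the branching rule for patterns\<close>

lemma atypical_append_rows: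
  assumes \<epsilon>: "\<epsilon> = 0 \<or> \<epsilon> = 1/2" and lam: "coset_partition \<epsilon> (Suc n) lam"
    and nu: "nu \<in> upper_rows \<epsilon> n lam" and mu: "mu \<in> lower_rows \<epsilon> n nu"
    and z: "z \<in> so_patterns n mu"
  shows "card (atypical (Suc n) (append_rows n lam nu z)) =
    card (atypical n z) + (if nu (Suc n) \<in> int_coset \<epsilon> then 0 else 1)"
proof -
  let ?w = "append_rows n lam nu z"
  have w: "?w (2 * n + 1, n + 1) = nu (Suc n)"
    using append_rows_simps(2)[of "n + 1" n lam nu z] by simp
  have "atypical (Suc n) ?w = {p \<in> odd_ends (Suc n). ?w p \<notin> int_coset \<epsilon>}"
    by (rule atypical_eq[OF \<epsilon> coset_partition_in_coset[OF lam] append_rows_in_so_patterns[OF assms]])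
  also have "\<dots> = {p \<in> odd_ends n. ?w p \<notin> int_coset \<epsilon>} \<union>
      (if nu (Suc n) \<in> int_coset \<epsilon> then {} else {(2 * n + 1, n + 1)})"
    using w by (auto simp: odd_ends_Suc)
  \<comment> \<open>The shapes \<open>mu\<close> and \<open>lam\<close> lie in the same coset, so
    the old odd ends keep their status and only the new one has to be counted.\<close>
  also have "{p \<in> odd_ends n. ?w p \<notin> int_coset \<epsilon>} = atypical n z"
    unfolding atypical_eq[OF \<epsilon> lower_rows_in_coset[OF mu] z]
    using odd_ends_subset[of n] by (auto simp: append_rows_simps(4))
  finally have "atypical (Suc n) ?w =
      atypical n z \<union> (if nu (Suc n) \<in> int_coset \<epsilon> then {} else {(2 * n + 1, n + 1)})" .
  moreover have "atypical n z \<subseteq> odd_ends n"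
    unfolding atypical_eq[OF \<epsilon> lower_rows_in_coset[OF mu] z] by blast
  then have "finite (atypical n z)" "(2 * n + 1, n + 1) \<notin> atypical n z"
    using finite_subset[OF _ finite_odd_ends] row_notin_array_indices(2)[of n "2 * n + 1"] by auto
  ultimately show ?thesis by simp
qed

lemma array_type_append_rows:
  assumes "i \<in> {1..n}"
  shows "array_type (append_rows n lam nu z) (2 * i) = array_type z (2 * i)"
    "array_type (append_rows n lam nu z) (2 * i - 1) = array_type z (2 * i - 1)"
  unfolding array_type_def
  using assms by (intro arg_cong2[of _ _ _ _ "(-)"] sum.cong append_rows_simps(3); auto)+

text \<open>With row sums |lam|, |nu|, |mu| the exponent is (|lam| - |nu|) - (|nu| - |mu|), whence
  the factor 2.\<close>

lemma array_type_append_rows_last: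
  assumes "\<And>j. j \<in> {1..n} \<Longrightarrow> z (2 * n, j) = mu j"
  shows "array_type (append_rows n lam nu z) (2 * Suc n) - array_type (append_rows n lam nu z) (2 * Suc n - 1)
    = (\<Sum>j=1..Suc n. lam j) - 2 * (\<Sum>j=1..Suc n. nu j) + (\<Sum>j=1..n. mu j)"
proof -
  let ?w = "append_rows n lam nu z"
  have "array_type ?w (2 * n + 2) = (\<Sum>j=1..n + 1. ?w (2 * n + 2, j)) - (\<Sum>j=1..n + 1. ?w (2 * n + 1, j))"
    by (simp add: array_type_def)
  also have "\<dots> = (\<Sum>j=1..n + 1. lam j) - (\<Sum>j=1..n + 1. nu j)"
    by (intro arg_cong2[of _ _ _ _ "(-)"] sum.cong append_rows_simps) auto
  finally have *: "array_type ?w (2 * n + 2) = (\<Sum>j=1..n + 1. lam j) - (\<Sum>j=1..n + 1. nu j)" .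
  have "array_type ?w (2 * n + 1) = (\<Sum>j=1..n + 1. ?w (2 * n + 1, j)) - (\<Sum>j=1..n. ?w (2 * n, j))"
    by (simp add: array_type_def)
  also have "\<dots> = (\<Sum>j=1..n + 1. nu j) - (\<Sum>j=1..n. mu j)"
    using assms
    by (intro arg_cong2[of _ _ _ _ "(-)"] sum.cong append_rows_simps) (auto simp: append_rows_simps(3))
  finally show ?thesis using * by simp
qed

lemma schur_CB_0 [simp]: "schur_CB 0 lam y b = 1"
  by (simp add: schur_CB_def so_patterns_0 atypical_def)

text \<open>Under the gluing bijection the weight of a pattern is the weight of the smaller pattern,
  times a power of the last variable, times \<open>b\<close> if the new odd end is atypical. Summing
  over the smaller patterns first leaves \<open>schur_CB n mu\<close>.\<close>

lemma schur_CB_Suc: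
  assumes \<epsilon>: "\<epsilon> = 0 \<or> \<epsilon> = 1/2" and lam: "coset_partition \<epsilon> (Suc n) lam"
  shows "schur_CB (Suc n) lam y b = (\<Sum>nu\<in>upper_rows \<epsilon> n lam. \<Sum>mu\<in>lower_rows \<epsilon> n nu.
     (if nu (Suc n) \<in> int_coset \<epsilon> then 1 else b) *
     half_pow (y (Suc n)) ((\<Sum>i=1..Suc n. lam i) - 2 * (\<Sum>i=1..Suc n. nu i) + (\<Sum>i=1..n. mu i)) *
     schur_CB n mu y b)"
proof -
  define wt where "wt m w = b ^ card (atypical m w) *
        (\<Prod>i=1..m. half_pow (y i) (array_type w (2 * i) - array_type w (2 * i - 1)))" for m w
  define v where "v nu mu = (if nu (Suc n) \<in> int_coset \<epsilon> then 1 else b) *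
     half_pow (y (Suc n)) ((\<Sum>i=1..Suc n. lam i) - 2 * (\<Sum>i=1..Suc n. nu i) + (\<Sum>i=1..n. mu i))"
    for nu mu :: "nat \<Rightarrow> rat"
  have wt: "wt (Suc n) (append_rows n lam nu z) = v nu mu * wt n z"
    if "nu \<in> upper_rows \<epsilon> n lam" "mu \<in> lower_rows \<epsilon> n nu" "z \<in> so_patterns n mu" for nu mu z
  proof -
    have "\<And>j. j \<in> {1..n} \<Longrightarrow> z (2 * n, j) = mu j"
      using that(3) by (simp add: so_patterns_def)
    note last = array_type_append_rows_last[where mu = mu and z = z and n = n, OF this]
    have "(\<Prod>i=1..n. half_pow (y i) (array_type (append_rows n lam nu z) (2 * i)
            - array_type (append_rows n lam nu z) (2 * i - 1)))
        = (\<Prod>i=1..n. half_pow (y i) (array_type z (2 * i) - array_type z (2 * i - 1)))"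
      by (intro prod.cong refl) (simp only: array_type_append_rows)
    then have "(\<Prod>i=1..Suc n. half_pow (y i) (array_type (append_rows n lam nu z) (2 * i)
            - array_type (append_rows n lam nu z) (2 * i - 1)))
        = (\<Prod>i=1..n. half_pow (y i) (array_type z (2 * i) - array_type z (2 * i - 1))) *
          half_pow (y (Suc n)) ((\<Sum>i=1..Suc n. lam i) - 2 * (\<Sum>i=1..Suc n. nu i) + (\<Sum>i=1..n. mu i))"
      by (simp only: prod.nat_ivl_Suc' last le_add2 plus_1_eq_Suc) simp
    then show ?thesis
      unfolding wt_def v_def atypical_append_rows[OF \<epsilon> lam that] by (simp add: power_add)
  qed
  have "schur_CB (Suc n) lam y b = (\<Sum>w\<in>so_patterns (Suc n) lam. wt (Suc n) w)"
    by (simp add: schur_CB_def wt_def)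
  also have "\<dots> = (\<Sum>(nu, mu, z)\<in>(SIGMA nu:upper_rows \<epsilon> n lam. SIGMA mu:lower_rows \<epsilon> n nu. so_patterns n mu).
      wt (Suc n) (append_rows n lam nu z))"
    by (subst sum.reindex_bij_betw[OF bij_betw_append_rows[OF assms], symmetric])
       (simp add: case_prod_unfold)
  also have "\<dots> = (\<Sum>(nu, mu, z)\<in>(SIGMA nu:upper_rows \<epsilon> n lam. SIGMA mu:lower_rows \<epsilon> n nu. so_patterns n mu).
      v nu mu * wt n z)"
    by (intro sum.cong) (auto simp: wt)
  also have "\<dots> = (\<Sum>nu\<in>upper_rows \<epsilon> n lam. \<Sum>(mu, z)\<in>(SIGMA mu:lower_rows \<epsilon> n nu. so_patterns n mu).
      v nu mu * wt n z)"
    using finite_so_patterns[OF \<epsilon>] lower_rows_coset_partition[OF lam]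
    by (intro sum.Sigma[symmetric]) auto
  also have "\<dots> = (\<Sum>nu\<in>upper_rows \<epsilon> n lam. \<Sum>mu\<in>lower_rows \<epsilon> n nu. \<Sum>z\<in>so_patterns n mu. v nu mu * wt n z)"
    using finite_so_patterns[OF \<epsilon>] lower_rows_coset_partition[OF lam]
    by (intro sum.cong refl sum.Sigma[symmetric]) auto
  also have "\<dots> = (\<Sum>nu\<in>upper_rows \<epsilon> n lam. \<Sum>mu\<in>lower_rows \<epsilon> n nu. v nu mu * schur_CB n mu y b)"
    by (simp add: schur_CB_def wt_def sum_distrib_left)
  finally show ?thesis by (simp add: v_def)
qed

subsection \<open>The branching rule for the determinants\<close>

text \<open>On \<open>half_lattice\<close> this is the least element of the coset that is at least
  \<open>q\<close>. As a lower bound for row \<open>2 * n\<close>, an atypical odd end acts exactly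
  like its rounding.\<close>

definition round_up :: "rat \<Rightarrow> rat \<Rightarrow> rat" where
  "round_up \<epsilon> q = (if q \<in> int_coset \<epsilon> then q else q + 1/2)"

lemma round_up_eq [simp]: "q \<in> int_coset \<epsilon> \<Longrightarrow> round_up \<epsilon> q = q"
  by (simp add: round_up_def)

lemma round_up_in_int_coset:
  "\<epsilon> = 0 \<or> \<epsilon> = 1/2 \<Longrightarrow> q \<in> half_lattice \<Longrightarrow> round_up \<epsilon> q \<in> int_coset \<epsilon>"
  by (simp add: round_up_def add_half_in_int_coset_iff)

text \<open>Elements of one coset differ by integers, so a slack of 1/2 is immaterial.\<close>

lemma int_coset_half_step:
  assumes "a \<in> int_coset \<epsilon>" "b \<in> int_coset \<epsilon>"
  shows "a \<le> b + 1/2 \<longleftrightarrow> a \<le> b"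
proof -
  obtain k where k: "b = a + of_int k" using assms by (rule int_coset_diffE)
  have "k \<ge> 0" if "of_int k \<ge> (- 1/2 :: rat)"
  proof (rule ccontr)
    assume "\<not> k \<ge> 0"
    then have "of_int k \<le> (of_int (- 1) :: rat)" unfolding of_int_le_iff by linarith
    then show False using that by simp
  qed
  then show ?thesis using k by auto
qed

lemma minus_double_in_half_lattice: "a \<in> half_lattice \<Longrightarrow> - 2 * a \<in> half_lattice"
  using half_lattice_closed(7)[OF double_in_half_lattice] by simp

lemma coset_interval_round_up:
  assumes "\<epsilon> = 0 \<or> \<epsilon> = 1/2" "a \<in> half_lattice"
  shows "coset_interval \<epsilon> (round_up \<epsilon> a) b = coset_interval \<epsilon> a b"
proof (cases "a \<in> int_coset \<epsilon>")
  case False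
  then have a: "a + 1/2 \<in> int_coset \<epsilon>" using add_half_in_int_coset_iff[OF assms] by simp
  have "a + 1/2 \<le> p \<longleftrightarrow> a \<le> p" if "p \<in> int_coset \<epsilon>" for p
    using int_coset_half_step[OF a that] by auto
  then show ?thesis using False by (auto simp: round_up_def coset_interval_def)
qed simp

text \<open>The second piece consists of the atypical values, parametrized by their roundings.
  Raising by 1/2 keeps them below \<open>L\<close>, since \<open>L\<close> is in the coset, and
  turns the lower bound 0 into 1/2, that is, into \<open>1 - \<epsilon>\<close> on the
  coset.\<close>

lemma half_lattice_interval_eq:
  assumes \<epsilon>: "\<epsilon> = 0 \<or> \<epsilon> = 1/2" and L: "L \<in> int_coset \<epsilon>"
  shows "{p \<in> half_lattice. 0 \<le> p \<and> p \<le> L} =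
    coset_interval \<epsilon> \<epsilon> L \<union> (\<lambda>q. q - 1/2) ` coset_interval \<epsilon> (1 - \<epsilon>) L"
    (is "?I = ?A \<union> ?B")
proof (intro equalityI subsetI)
  fix p assume p: "p \<in> ?I"
  show "p \<in> ?A \<union> ?B"
  proof (cases "p \<in> int_coset \<epsilon>")
    case True
    then show ?thesis
      using p int_coset_lower_bound(1)[OF \<epsilon> True] by (auto simp: coset_interval_def)
  next
    case False
    then have q: "p + 1/2 \<in> int_coset \<epsilon>" using p add_half_in_int_coset_iff[OF \<epsilon>] by auto
    have "p + 1/2 \<in> coset_interval \<epsilon> (1 - \<epsilon>) L"
      using p q int_coset_lower_bound(2)[OF \<epsilon> q] int_coset_half_step[OF q L]
      by (auto simp: coset_interval_def)
    then show ?thesis by (intro UnI2 image_eqI[of _ _ "p + 1/2"]) auto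
  qed
next
  fix p assume "p \<in> ?A \<union> ?B"
  then show "p \<in> ?I"
  proof
    assume "p \<in> ?A"
    then show ?thesis
      using \<epsilon> int_coset_sub_half_lattice[OF \<epsilon>] by (auto simp: coset_interval_def)
  next
    assume "p \<in> ?B"
    then obtain q where q: "p = q - 1/2" "q \<in> int_coset \<epsilon>" "1 - \<epsilon> \<le> q" "q \<le> L"
      by (auto simp: coset_interval_def)
    then show ?thesis
      using \<epsilon> int_coset_sub_half_lattice[OF \<epsilon>] by auto
  qed
qed

lemma sum_half_lattice_interval:
  fixes f :: "rat \<Rightarrow> 'a::comm_monoid_add"
  assumes \<epsilon>: "\<epsilon> = 0 \<or> \<epsilon> = 1/2" and L: "L \<in> int_coset \<epsilon>"
  shows "(\<Sum>p | p \<in> half_lattice \<and> 0 \<le> p \<and> p \<le> L. f p) =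
    (\<Sum>p\<in>coset_interval \<epsilon> \<epsilon> L. f p) + (\<Sum>q\<in>coset_interval \<epsilon> (1 - \<epsilon>) L. f (q - 1/2))"
proof -
  have "q - 1/2 \<notin> int_coset \<epsilon>" if "q \<in> int_coset \<epsilon>" for q
  proof -
    have "q - 1/2 \<in> half_lattice" using that int_coset_sub_half_lattice[OF \<epsilon>] by auto
    then show ?thesis using add_half_in_int_coset_iff[OF \<epsilon>, of "q - 1/2"] that by simp
  qed
  then have "coset_interval \<epsilon> \<epsilon> L \<inter> (\<lambda>q. q - 1/2) ` coset_interval \<epsilon> (1 - \<epsilon>) L = {}"
    by (auto simp: coset_interval_def)
  moreover have "inj_on (\<lambda>q. q - 1/2 :: rat) (coset_interval \<epsilon> (1 - \<epsilon>) L)"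
    by (auto intro: inj_onI)
  ultimately show ?thesis
    unfolding half_lattice_interval_eq[OF assms]
    by (simp add: sum.union_disjoint sum.reindex)
qed

text \<open>What the induction step needs of the entries: the recurrence makes the columns of the
  old variables telescope, the constant in \<open>casorati\<close> takes care of the column of the
  new variable, and \<open>boundary\<close> cancels the lower ends of the sum over the odd end. Both
  numerators and the denominator are instances.\<close>

locale branching =
  fixes \<epsilon> :: rat and n :: nat and y :: "nat \<Rightarrow> 'a::field" and b :: 'a and \<phi> :: "rat \<Rightarrow> nat \<Rightarrow> 'a"
    and lam :: "nat \<Rightarrow> rat"
  assumes eps: "\<epsilon> = 0 \<or> \<epsilon> = 1/2"
    and lam: "coset_partition \<epsilon> (Suc n) lam"
    and y_nonzero: "y (Suc n) \<noteq> 0"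
    and recurrence: "\<And>p j. p \<in> int_coset \<epsilon> \<Longrightarrow> j \<in> {1..n} \<Longrightarrow>
       \<phi> (p + 1) j + \<phi> (p - 1) j = ((y j)\<^sup>2 + inverse ((y j)\<^sup>2)) * \<phi> p j"
    and casorati: "\<And>p. p \<in> int_coset \<epsilon> \<Longrightarrow>
       half_pow (y (Suc n)) (p - 1) * \<phi> p (Suc n) - half_pow (y (Suc n)) p * \<phi> (p - 1) (Suc n)
       = (1 - inverse ((y (Suc n))\<^sup>2) ^ 2) * (1 + b * (y (Suc n))\<^sup>2)"
    and boundary: "\<And>j. j \<in> {1..Suc n} \<Longrightarrow>
       half_pow (y (Suc n)) (- \<epsilon>) * \<phi> (\<epsilon> - 1) j + b * half_pow (y (Suc n)) \<epsilon> * \<phi> (- \<epsilon>) j = 0"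
    and factor_nonzero: "1 + b * (y (Suc n))\<^sup>2 \<noteq> 0"
begin

abbreviation h :: "rat \<Rightarrow> 'a" where "h \<equiv> half_pow (y (Suc n))"

abbreviation t :: 'a where "t \<equiv> (y (Suc n))\<^sup>2"

definition c :: 'a where "c = (1 - inverse t ^ 2) * (1 + b * t)"

text \<open>The Casoratian (discrete Wronskian) of the sequences \<open>h\<close> and
  \<open>\<phi>\<close> in the index \<open>p\<close>.\<close>

definition g :: "rat \<Rightarrow> nat \<Rightarrow> 'a" where
  "g p j = h (p - 1) * \<phi> p j - h p * \<phi> (p - 1) j"

text \<open>Up to the factor \<open>inverse t\<close>, the quotient of \<open>\<phi>\<close> by
  \<open>h\<close>.\<close>

definition V :: "rat \<Rightarrow> nat \<Rightarrow> 'a" where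
  "V p j = h (- p - 1) * \<phi> p j"

definition part :: "nat \<Rightarrow> rat" where
  "part i = lam i + of_nat (Suc n) - of_nat i"

lemma coset_half: "p \<in> int_coset \<epsilon> \<Longrightarrow> p \<in> half_lattice"
  using int_coset_sub_half_lattice[OF eps] by blast

lemmas h_add = half_pow_add[OF y_nonzero]
lemmas h_diff = half_pow_diff[OF y_nonzero]
lemmas h_minus = half_pow_minus[OF y_nonzero]

text \<open>Green's identity: \<open>h\<close> and \<open>\<phi>\<close> solve three-term
  recurrences that differ only in the constant, so the increment of their Casoratian is the
  difference of the constants times their product.\<close>

lemma g_telescope:
  assumes "p \<in> int_coset \<epsilon>" "j \<in> {1..n}"
  shows "(((y j)\<^sup>2 + inverse ((y j)\<^sup>2)) - (t + inverse t)) * (h p * \<phi> p j) = g (p + 1) j - g p j"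
proof -
  have p: "p \<in> half_lattice" using coset_half assms by blast
  have "g (p + 1) j - g p j = h p * (\<phi> (p + 1) j + \<phi> (p - 1) j) - (h (p + 1) + h (p - 1)) * \<phi> p j"
    by (simp add: g_def algebra_simps)
  also have "h (p + 1) + h (p - 1) = h p * (t + inverse t)"
    using p by (simp add: h_add h_diff distrib_left divide_inverse)
  finally show ?thesis
    unfolding recurrence[OF assms] by (simp only: left_diff_distrib right_diff_distrib mult_ac)
qed

text \<open>The discrete quotient rule: the difference of a quotient is the Casoratian divided by
  the product of two consecutive denominators, here \<open>h p * h (p - 1)\<close>.\<close>

lemma V_telescope:
  assumes "p \<in> int_coset \<epsilon>"
  shows "h (- 2 * p) * g p j = V p j - V (p - 1) j"
proof -
  have p: "p \<in> half_lattice" using coset_half assms by blast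
  then have "- 2 * p \<in> half_lattice" by simp
  then have "h (- 2 * p) * h (p - 1) = h (- p - 1)" "h (- 2 * p) * h p = h (- p)"
    using h_add[of "- 2 * p" "p - 1"] h_add[of "- 2 * p" p] p by simp_all
  then show ?thesis
    by (simp add: g_def V_def right_diff_distrib mult.assoc[symmetric])
qed

lemma round_up_upper_row:
  assumes "nu \<in> upper_rows \<epsilon> n lam" "i \<in> {1..Suc n}"
  shows "round_up \<epsilon> (nu i) \<in> int_coset \<epsilon>"
proof -
  have "nu i \<in> half_lattice"
    using upper_rowsD(1)[OF assms(1)] upper_rowsD(4)[OF assms(1), of i] assms(2) coset_half
    by (cases "i = Suc n") auto
  then show ?thesis by (rule round_up_in_int_coset[OF eps])
qed

text \<open>The factors of the product go into the columns and the powers \<open>h (mu i)\<close>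
  into the rows; every entry then telescopes to a difference of consecutive rows of
  \<open>g\<close>. Bordering by a column of ones absorbs the differences and raises the size to
  \<open>Suc n\<close>.\<close>

lemma sum_lower_rows:
  assumes nu: "nu \<in> upper_rows \<epsilon> n lam"
  shows "(\<Sum>mu\<in>lower_rows \<epsilon> n nu. h (\<Sum>i=1..n. mu i) * det_1n n (\<lambda>i j. \<phi> (mu i + of_nat n - of_nat i) j)) *
      (\<Prod>j=1..n. ((y j)\<^sup>2 + inverse ((y j)\<^sup>2)) - (t + inverse t)) =
    (\<Prod>i=1..n. h (of_nat i - of_nat n)) *
    det_1n (Suc n) (\<lambda>i j. if j = Suc n then 1 else g (round_up \<epsilon> (nu i) + of_nat (Suc n) - of_nat i) j)"
proof -
  define d where "d j = ((y j)\<^sup>2 + inverse ((y j)\<^sup>2)) - (t + inverse t)" for j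
  define P where "P i = round_up \<epsilon> (nu i) + of_nat (Suc n) - of_nat i" for i
  define f where "f i j = (if j = Suc n then 1 else g (P i) j)" for i j
  have summand: "h (\<Sum>i=1..n. mu i) * det_1n n (\<lambda>i j. \<phi> (mu i + of_nat n - of_nat i) j) * (\<Prod>j=1..n. d j) =
      det_1n n (\<lambda>i j. d j * (h (mu i) * \<phi> (mu i + of_nat n - of_nat i) j))"
    if "mu \<in> lower_rows \<epsilon> n nu" for mu
  proof -
    have "h (\<Sum>i=1..n. mu i) = (\<Prod>i=1..n. h (mu i))"
      using lower_rowsD(1)[OF that] coset_half by (intro half_pow_sum y_nonzero) auto
    then show ?thesis by (simp add: det_1n_scale_rows det_1n_scale_columns)
  qed
  have entry: "(\<Sum>m\<in>coset_interval \<epsilon> (nu (Suc i)) (nu i). d j * (h m * \<phi> (m + of_nat n - of_nat i) j))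
      = h (of_nat i - of_nat n) * (g (P i) j - g (P (Suc i)) j)"
    if i: "i \<in> {1..n}" and j: "j \<in> {1..n}" for i j
  proof -
    let ?e = "of_nat n - of_nat i :: rat"
    have e: "?e \<in> \<int>" by simp
    have step: "d j * (h m * \<phi> (m + of_nat n - of_nat i) j)
        = h (of_nat i - of_nat n) * (g (m + ?e + 1) j - g (m - 1 + ?e + 1) j)"
      if m: "m \<in> int_coset \<epsilon>" for m
    proof -
      have me: "m + ?e \<in> int_coset \<epsilon>" using m e by blast
      have "h m = h ((of_nat i - of_nat n) + (m + ?e))" by simp
      also have "\<dots> = h (of_nat i - of_nat n) * h (m + ?e)"
        using coset_half[OF me] by (intro h_add) auto
      finally have "d j * (h m * \<phi> (m + of_nat n - of_nat i) j)
          = h (of_nat i - of_nat n) * (d j * (h (m + ?e) * \<phi> (m + ?e) j))"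
        by (simp only: add_diff_eq mult_ac)
      also have "d j * (h (m + ?e) * \<phi> (m + ?e) j) = g (m + ?e + 1) j - g (m + ?e) j"
        unfolding d_def by (rule g_telescope[OF me j])
      also have "m + ?e = m - 1 + ?e + 1" by simp
      finally show ?thesis by simp
    qed
    have nui: "nu i \<in> int_coset \<epsilon>" using upper_rowsD(4)[OF nu i] .
    have hl: "nu (Suc i) \<in> half_lattice"
      using upper_rowsD(1)[OF nu] upper_rowsD(4)[OF nu, of "Suc i"] coset_half i
      by (cases "Suc i = Suc n") auto
    \<comment> \<open>\<open>lam (Suc i)\<close> separates the two entries of \<open>nu\<close>, and
      rounding adds at most 1/2, so the telescoping lemma applies.\<close>
    have "nu (Suc i) \<le> lam (Suc i)"
      using upper_rowsD(3)[OF nu] upper_rowsD(6)[OF nu, of "Suc i"] i by (cases "Suc i = Suc n") auto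
    also have "\<dots> \<le> nu i" using upper_rowsD(5)[OF nu i] .
    finally have le: "round_up \<epsilon> (nu (Suc i)) \<le> nu i + 1"
      by (simp add: round_up_def)
    have "(\<Sum>m\<in>coset_interval \<epsilon> (nu (Suc i)) (nu i). d j * (h m * \<phi> (m + of_nat n - of_nat i) j))
        = (\<Sum>m\<in>coset_interval \<epsilon> (round_up \<epsilon> (nu (Suc i))) (nu i).
            h (of_nat i - of_nat n) * (g (m + ?e + 1) j - g (m - 1 + ?e + 1) j))"
      unfolding coset_interval_round_up[OF eps hl]
      by (intro sum.cong refl step) (simp add: coset_interval_def)
    also have "\<dots> = h (of_nat i - of_nat n) *
        (g (nu i + ?e + 1) j - g (round_up \<epsilon> (nu (Suc i)) - 1 + ?e + 1) j)"
      unfolding sum_distrib_left[symmetric]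
      by (subst sum_coset_interval_telescope[OF round_up_in_int_coset[OF eps hl] nui le, of "\<lambda>m. g (m + ?e + 1) j"]) simp
    also have "nu i + ?e + 1 = P i" using nui by (simp add: P_def)
    \<comment> \<open>The unit lost at the lower end of the telescope is the unit by which the
      staircase drops from row \<open>i\<close> to row \<open>Suc i\<close>, so row \<open>i\<close>
      ends where the next one begins.\<close>
    also have "round_up \<epsilon> (nu (Suc i)) - 1 + ?e + 1 = P (Suc i)" by (simp add: P_def)
    finally show ?thesis .
  qed
  have "(\<Sum>mu\<in>lower_rows \<epsilon> n nu. h (\<Sum>i=1..n. mu i) * det_1n n (\<lambda>i j. \<phi> (mu i + of_nat n - of_nat i) j)) * (\<Prod>j=1..n. d j)
      = (\<Sum>mu\<in>lower_rows \<epsilon> n nu. det_1n n (\<lambda>i j. d j * (h (mu i) * \<phi> (mu i + of_nat n - of_nat i) j)))"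
    by (simp only: sum_distrib_right summand cong: sum.cong)
  also have "\<dots> = det_1n n (\<lambda>i j. \<Sum>m\<in>coset_interval \<epsilon> (nu (Suc i)) (nu i). d j * (h m * \<phi> (m + of_nat n - of_nat i) j))"
    unfolding lower_rows_def by (rule det_1n_sum_rows[symmetric]) simp
  also have "\<dots> = det_1n n (\<lambda>i j. h (of_nat i - of_nat n) * (g (P i) j - g (P (Suc i)) j))"
    by (rule det_1n_cong) (rule entry)
  also have "\<dots> = (\<Prod>i=1..n. h (of_nat i - of_nat n)) * det_1n n (\<lambda>i j. g (P i) j - g (P (Suc i)) j)"
    by (rule det_1n_scale_rows)
  \<comment> \<open>Differences annihilate the column of ones in \<open>f\<close> except in the last
    row, where the entry is 1, so the bordered determinant has the same value.\<close>
  also have "det_1n n (\<lambda>i j. g (P i) j - g (P (Suc i)) j)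
      = det_1n n (\<lambda>i j. if i < Suc n then f i j - f (Suc i) j else f i j)"
    by (rule det_1n_cong) (simp add: f_def)
  also have "\<dots> = det_1n (Suc n) (\<lambda>i j. if i < Suc n then f i j - f (Suc i) j else f i j)"
    by (rule det_1n_last_column_unit[symmetric]) (auto simp: f_def)
  also have "\<dots> = det_1n (Suc n) f"
    by (rule det_1n_row_differences)
  finally show ?thesis unfolding d_def f_def[abs_def] P_def .
qed

text \<open>In the column of the new variable \<open>g\<close> is the constant \<open>c\<close>
  whatever the row, so scaling the column of ones by \<open>c\<close> produces that column.\<close>

lemma c_times_det:
  assumes nu: "nu \<in> upper_rows \<epsilon> n lam"
  shows "c * det_1n (Suc n) (\<lambda>i j. if j = Suc n then 1 else g (round_up \<epsilon> (nu i) + of_nat (Suc n) - of_nat i) j)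
    = det_1n (Suc n) (\<lambda>i j. g (round_up \<epsilon> (nu i) + of_nat (Suc n) - of_nat i) j)"
proof -
  define P where "P i = round_up \<epsilon> (nu i) + of_nat (Suc n) - of_nat i" for i
  have last: "g (P i) (Suc n) = c" if "i \<in> {1..Suc n}" for i
  proof -
    have "round_up \<epsilon> (nu i) + (of_nat (Suc n) - of_nat i) \<in> int_coset \<epsilon>"
      by (intro int_coset_add_int round_up_upper_row[OF nu that]) simp
    then have "P i \<in> int_coset \<epsilon>" by (simp only: P_def add_diff_eq)
    then show ?thesis using casorati by (simp add: g_def c_def)
  qed
  have "c = (\<Prod>j=1..Suc n. if j = Suc n then c else 1)" by simp
  also have "\<dots> * det_1n (Suc n) (\<lambda>i j. if j = Suc n then 1 else g (P i) j)
      = det_1n (Suc n) (\<lambda>i j. (if j = Suc n then c else 1) * (if j = Suc n then 1 else g (P i) j))"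
    by (rule det_1n_scale_columns[symmetric])
  also have "\<dots> = det_1n (Suc n) (\<lambda>i j. g (P i) j)"
    by (rule det_1n_cong) (simp add: last)
  finally show ?thesis by (simp only: P_def)
qed

lemma part_in_coset: "i \<in> {1..Suc n} \<Longrightarrow> part i \<in> int_coset \<epsilon>"
proof -
  assume "i \<in> {1..Suc n}"
  then have "lam i + (of_nat (Suc n) - of_nat i) \<in> int_coset \<epsilon>"
    by (intro int_coset_add_int coset_partitionD(1)[OF lam]) simp_all
  then show ?thesis by (simp only: part_def add_diff_eq)
qed

lemma sum_inner_row:
  assumes i: "i \<in> {1..n}"
  shows "(\<Sum>q\<in>coset_interval \<epsilon> (lam (Suc i)) (lam i).
      h (- 2 * q) * g (round_up \<epsilon> q + of_nat (Suc n) - of_nat i) j)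
    = h (2 * (of_nat (Suc n) - of_nat i)) * (V (part i) j - V (part (Suc i)) j)"
proof -
  let ?e = "of_nat (Suc n) - of_nat i :: rat"
  have lam_i: "lam (Suc i) \<in> int_coset \<epsilon>" "lam i \<in> int_coset \<epsilon>" "lam (Suc i) \<le> lam i"
    using coset_partitionD[OF lam, of i] coset_partitionD[OF lam, of "Suc i"] i by auto
  have step: "h (- 2 * q) * g (round_up \<epsilon> q + of_nat (Suc n) - of_nat i) j
      = h (2 * ?e) * (V (q + ?e) j - V (q - 1 + ?e) j)" if q: "q \<in> int_coset \<epsilon>" for q
  proof -
    have qe: "q + ?e \<in> int_coset \<epsilon>" using q by (rule int_coset_add_int) simp
    \<comment> \<open>The exponent is recentred at the index \<open>q + ?e\<close> at which
      \<open>V_telescope\<close> is applied; the correction does not depend on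
      \<open>q\<close>.\<close>
    have "h (- 2 * q) = h (2 * ?e + (- 2 * (q + ?e)))" by (simp add: algebra_simps)
    also have "\<dots> = h (2 * ?e) * h (- 2 * (q + ?e))"
      using coset_half[OF qe]
      by (intro h_add minus_double_in_half_lattice double_in_half_lattice half_lattice_closed(3,6))
    finally have "h (- 2 * q) * g (q + ?e) j = h (2 * ?e) * (V (q + ?e) j - V (q + ?e - 1) j)"
      using V_telescope[OF qe, of j] by (simp only: mult.assoc)
    moreover have "q + ?e - 1 = q - 1 + ?e" by simp
    ultimately show ?thesis using q by (simp only: round_up_eq add_diff_eq)
  qed
  have "(\<Sum>q\<in>coset_interval \<epsilon> (lam (Suc i)) (lam i).
      h (- 2 * q) * g (round_up \<epsilon> q + of_nat (Suc n) - of_nat i) j)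
     = (\<Sum>q\<in>coset_interval \<epsilon> (lam (Suc i)) (lam i). h (2 * ?e) * (V (q + ?e) j - V (q - 1 + ?e) j))"
    by (intro sum.cong refl step) (simp add: coset_interval_def)
  also have "\<dots> = h (2 * ?e) * (V (lam i + ?e) j - V (lam (Suc i) - 1 + ?e) j)"
    unfolding sum_distrib_left[symmetric]
    using lam_i by (subst sum_coset_interval_telescope[of _ _ _ "\<lambda>q. V (q + ?e) j"]) auto
  finally show ?thesis by (simp add: part_def algebra_simps)
qed

text \<open>Typical and atypical values give the same telescoping sum of \<open>V\<close>, the
  atypical ones with an extra factor \<open>b * t\<close>. The two lower ends cancel by
  \<open>boundary\<close>, which leaves \<open>1 + b * t\<close> times the common upper end.\<close>

lemma sum_last_row:
  assumes j: "j \<in> {1..Suc n}"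
  shows "(\<Sum>q | q \<in> half_lattice \<and> 0 \<le> q \<and> q \<le> lam (Suc n).
      (if q \<in> int_coset \<epsilon> then 1 else b) * (h (- 2 * q) * g (round_up \<epsilon> q) j))
    = (1 + b * t) * V (lam (Suc n)) j"
proof -
  let ?L = "lam (Suc n)"
  have L: "?L \<in> int_coset \<epsilon>" "?L \<ge> 0" using coset_partitionD[OF lam, of "Suc n"] by auto
  have e: "\<epsilon> \<in> int_coset \<epsilon>" "1 - \<epsilon> \<in> int_coset \<epsilon>" "0 \<le> \<epsilon>" "\<epsilon> \<le> 1"
    using eps by (auto simp: int_coset_def intro: exI[of _ 0] exI[of _ 1])
  then have e_half: "\<epsilon> \<in> half_lattice" using coset_half by blast
  let ?f = "\<lambda>q. (if q \<in> int_coset \<epsilon> then 1 else b) * (h (- 2 * q) * g (round_up \<epsilon> q) j)"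
  have typical: "?f q = V q j - V (q - 1) j" if "q \<in> coset_interval \<epsilon> \<epsilon> ?L" for q
    using that V_telescope[of q j] by (simp add: coset_interval_def)
  have atypical: "?f (q - 1/2) = b * t * (V q j - V (q - 1) j)" if "q \<in> coset_interval \<epsilon> (1 - \<epsilon>) ?L" for q
  proof -
    have q: "q \<in> int_coset \<epsilon>" using that by (simp add: coset_interval_def)
    then have "q - 1/2 \<in> half_lattice" using coset_half by auto
    then have "q - 1/2 \<notin> int_coset \<epsilon>" using add_half_in_int_coset_iff[OF eps, of "q - 1/2"] q by simp
    \<comment> \<open>The odd end enters the exponent with coefficient -2, so lowering it by 1/2
      contributes one factor \<open>t\<close>.\<close>
    moreover have "h (- 2 * (q - 1/2)) = t * h (- 2 * q)"
      using h_add[OF half_lattice_closed(2) minus_double_in_half_lattice[OF coset_half[OF q]]]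
      by (simp add: algebra_simps)
    ultimately show ?thesis
      using V_telescope[OF q, of j] by (simp add: round_up_def mult.assoc)
  qed
  have "(\<Sum>q | q \<in> half_lattice \<and> 0 \<le> q \<and> q \<le> ?L. ?f q)
      = (\<Sum>q\<in>coset_interval \<epsilon> \<epsilon> ?L. V q j - V (q - 1) j)
        + (\<Sum>q\<in>coset_interval \<epsilon> (1 - \<epsilon>) ?L. b * t * (V q j - V (q - 1) j))"
    unfolding sum_half_lattice_interval[OF eps L(1)]
    by (intro arg_cong2[of _ _ _ _ "(+)"] sum.cong refl typical atypical)
  also have "\<dots> = (V ?L j - V (\<epsilon> - 1) j) + b * t * (V ?L j - V (1 - \<epsilon> - 1) j)"
    unfolding sum_distrib_left[symmetric]
    using L e by (simp add: sum_coset_interval_telescope[of _ _ _ "\<lambda>q. V q j"])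
  also have "\<dots> = (1 + b * t) * V ?L j - (V (\<epsilon> - 1) j + b * t * V (- \<epsilon>) j)"
    by (simp add: algebra_simps)
  also have "V (\<epsilon> - 1) j + b * t * V (- \<epsilon>) j = h (- \<epsilon>) * \<phi> (\<epsilon> - 1) j + b * h \<epsilon> * \<phi> (- \<epsilon>) j"
  proof -
    have "t * h (\<epsilon> - 1) = h \<epsilon>" using h_add[of 1 "\<epsilon> - 1"] e_half by simp
    then have "b * t * (h (\<epsilon> - 1) * \<phi> (- \<epsilon>) j) = b * h \<epsilon> * \<phi> (- \<epsilon>) j"
      by (metis mult.assoc)
    then show ?thesis by (simp add: V_def)
  qed
  finally show ?thesis using boundary[OF j] by simp
qed

text \<open>The weight is a product over the rows, with the factor \<open>b\<close> of an atypical
  odd end placed in the last one. Each row sum telescopes to a difference of rows of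
  \<open>V\<close>, and the powers in \<open>V\<close> are then pulled out of the rows.\<close>

lemma sum_upper_rows:
  "(\<Sum>nu\<in>upper_rows \<epsilon> n lam. (if nu (Suc n) \<in> int_coset \<epsilon> then 1 else b) * h (- 2 * (\<Sum>i=1..Suc n. nu i)) *
      det_1n (Suc n) (\<lambda>i j. g (round_up \<epsilon> (nu i) + of_nat (Suc n) - of_nat i) j))
   = (1 + b * t) * (\<Prod>i=1..Suc n. h (2 * (of_nat (Suc n) - of_nat i)) * h (- part i - 1)) *
     det_1n (Suc n) (\<lambda>i j. \<phi> (part i) j)"
proof -
  define S where "S i = (if i = Suc n then {p \<in> half_lattice. 0 \<le> p \<and> p \<le> lam i}
      else coset_interval \<epsilon> (lam (Suc i)) (lam i))" for i
  define \<omega> where "\<omega> i q = (if i = Suc n \<and> q \<notin> int_coset \<epsilon> then b else 1) * h (- 2 * q)" for i q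
  \<comment> \<open>The scalar that row \<open>i\<close> acquires on summation;
    \<open>1 + b * t\<close> comes from the odd end alone.\<close>
  define \<rho> where "\<rho> i = h (2 * (of_nat (Suc n) - of_nat i)) * (if i = Suc n then 1 + b * t else 1)" for i
  have summand: "(if nu (Suc n) \<in> int_coset \<epsilon> then 1 else b) * h (- 2 * (\<Sum>i=1..Suc n. nu i)) *
      det_1n (Suc n) (\<lambda>i j. g (round_up \<epsilon> (nu i) + of_nat (Suc n) - of_nat i) j)
     = det_1n (Suc n) (\<lambda>i j. \<omega> i (nu i) * g (round_up \<epsilon> (nu i) + of_nat (Suc n) - of_nat i) j)"
    if nu: "nu \<in> upper_rows \<epsilon> n lam" for nu
  proof -
    have hl: "nu i \<in> half_lattice" if "i \<in> {1..Suc n}" for i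
      using upper_rowsD(1)[OF nu] upper_rowsD(4)[OF nu, of i] that coset_half
      by (cases "i = Suc n") auto
    have "- 2 * (\<Sum>i=1..Suc n. nu i) = (\<Sum>i=1..Suc n. - 2 * nu i)"
      by (rule sum_distrib_left)
    then have "h (- 2 * (\<Sum>i=1..Suc n. nu i)) = (\<Prod>i=1..Suc n. h (- 2 * nu i))"
      using hl by (subst half_pow_sum[OF y_nonzero, symmetric]) auto
    moreover have "(\<Prod>i=1..Suc n. if i = Suc n \<and> nu i \<notin> int_coset \<epsilon> then b else 1)
        = (if nu (Suc n) \<in> int_coset \<epsilon> then 1 else b)"
      by simp
    ultimately show ?thesis
      by (simp only: \<omega>_def det_1n_scale_rows prod.distrib)
  qed
  have entry: "(\<Sum>q\<in>S i. \<omega> i q * g (round_up \<epsilon> q + of_nat (Suc n) - of_nat i) j)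
      = \<rho> i * (if i < Suc n then V (part i) j - V (part (Suc i)) j else V (part i) j)"
    if "i \<in> {1..Suc n}" "j \<in> {1..Suc n}" for i j
  proof (cases "i = Suc n")
    case True
    have "(\<Sum>q\<in>S i. \<omega> i q * g (round_up \<epsilon> q + of_nat (Suc n) - of_nat i) j)
       = (\<Sum>q | q \<in> half_lattice \<and> 0 \<le> q \<and> q \<le> lam (Suc n).
      (if q \<in> int_coset \<epsilon> then 1 else b) * (h (- 2 * q) * g (round_up \<epsilon> q) j))"
      by (intro sum.cong) (auto simp: S_def True \<omega>_def)
    also have "\<dots> = (1 + b * t) * V (lam (Suc n)) j"
      by (rule sum_last_row[OF that(2)])
    finally show ?thesis by (simp add: True \<rho>_def part_def)
  next
    case False
    then show ?thesis
      using that sum_inner_row[of i j] by (simp add: S_def \<omega>_def \<rho>_def)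
  qed
  have "(\<Sum>nu\<in>upper_rows \<epsilon> n lam. (if nu (Suc n) \<in> int_coset \<epsilon> then 1 else b) * h (- 2 * (\<Sum>i=1..Suc n. nu i)) *
      det_1n (Suc n) (\<lambda>i j. g (round_up \<epsilon> (nu i) + of_nat (Suc n) - of_nat i) j))
      = (\<Sum>nu\<in>upper_rows \<epsilon> n lam. det_1n (Suc n) (\<lambda>i j. \<omega> i (nu i) * g (round_up \<epsilon> (nu i) + of_nat (Suc n) - of_nat i) j))"
    by (intro sum.cong refl summand)
  also have "\<dots> = det_1n (Suc n) (\<lambda>i j. \<Sum>q\<in>S i. \<omega> i q * g (round_up \<epsilon> q + of_nat (Suc n) - of_nat i) j)"
    unfolding upper_rows_def S_def[symmetric]
    by (rule det_1n_sum_rows[symmetric]) (simp add: S_def)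
  also have "\<dots> = det_1n (Suc n) (\<lambda>i j. \<rho> i * (if i < Suc n then V (part i) j - V (part (Suc i)) j else V (part i) j))"
    by (rule det_1n_cong) (rule entry)
  also have "\<dots> = (\<Prod>i=1..Suc n. \<rho> i) * det_1n (Suc n) (\<lambda>i j. V (part i) j)"
    unfolding det_1n_scale_rows det_1n_row_differences[of "Suc n" "\<lambda>i j. V (part i) j"] ..
  also have "det_1n (Suc n) (\<lambda>i j. V (part i) j) = (\<Prod>i=1..Suc n. h (- part i - 1)) * det_1n (Suc n) (\<lambda>i j. \<phi> (part i) j)"
    unfolding V_def by (rule det_1n_scale_rows)
  also have "(\<Prod>i=1..Suc n. \<rho> i) = (1 + b * t) * (\<Prod>i=1..Suc n. h (2 * (of_nat (Suc n) - of_nat i)))"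
    unfolding \<rho>_def prod.distrib by simp
  finally show ?thesis by (simp only: prod.distrib mult_ac)
qed

text \<open>In row \<open>i\<close> the exponents of the first and last products add up to
  \<open>n - i\<close>. For \<open>i \<le> n\<close> this cancels against the middle product, and
  the row \<open>i = n + 1\<close> leaves exponent -1.\<close>

lemma power_bookkeeping:
  "h (\<Sum>i=1..Suc n. lam i) * (\<Prod>i=1..n. h (of_nat i - of_nat n)) *
     (\<Prod>i=1..Suc n. h (2 * (of_nat (Suc n) - of_nat i)) * h (- part i - 1)) = inverse t"
proof -
  have "h (\<Sum>i=1..Suc n. lam i) = (\<Prod>i=1..Suc n. h (lam i))"
    using coset_partitionD(1)[OF lam] coset_half by (intro half_pow_sum y_nonzero) auto
  moreover have "h (lam i) * (h (2 * (of_nat (Suc n) - of_nat i)) * h (- part i - 1)) = h (of_nat n - of_nat i)"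
    if "i \<in> {1..Suc n}" for i
  proof -
    have *: "lam i \<in> half_lattice" "part i \<in> half_lattice"
      using coset_partitionD(1)[OF lam that] part_in_coset[OF that] coset_half by auto
    have "h (lam i) * (h (2 * (of_nat (Suc n) - of_nat i)) * h (- part i - 1))
        = h (lam i + (2 * (of_nat (Suc n) - of_nat i) + (- part i - 1)))"
    proof -
      have "h (2 * (of_nat (Suc n) - of_nat i) + (- part i - 1))
          = h (2 * (of_nat (Suc n) - of_nat i)) * h (- part i - 1)"
        by (intro h_add double_in_half_lattice half_lattice_closed *)
      moreover have "h (lam i + (2 * (of_nat (Suc n) - of_nat i) + (- part i - 1)))
          = h (lam i) * h (2 * (of_nat (Suc n) - of_nat i) + (- part i - 1))"
        by (intro h_add double_in_half_lattice half_lattice_closed *)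
      ultimately show ?thesis by simp
    qed
    also have "lam i + (2 * (of_nat (Suc n) - of_nat i) + (- part i - 1)) = of_nat n - of_nat i"
      by (simp add: part_def)
    finally show ?thesis .
  qed
  ultimately have "h (\<Sum>i=1..Suc n. lam i) * (\<Prod>i=1..Suc n. h (2 * (of_nat (Suc n) - of_nat i)) * h (- part i - 1))
      = (\<Prod>i=1..Suc n. h (of_nat n - of_nat i))"
    by (simp only: prod.distrib[symmetric] cong: prod.cong)
  also have "\<dots> = h (- 1) * (\<Prod>i=1..n. h (of_nat n - of_nat i))"
    by (simp add: prod.nat_ivl_Suc')
  also have "h (- 1) = inverse t" by (simp add: h_minus)
  finally have eq: "h (\<Sum>i=1..Suc n. lam i) * (\<Prod>i=1..Suc n. h (2 * (of_nat (Suc n) - of_nat i)) * h (- part i - 1))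
     = inverse t * (\<Prod>i=1..n. h (of_nat n - of_nat i))" .
  have "h (\<Sum>i=1..Suc n. lam i) * (\<Prod>i=1..n. h (of_nat i - of_nat n)) *
     (\<Prod>i=1..Suc n. h (2 * (of_nat (Suc n) - of_nat i)) * h (- part i - 1))
     = h (\<Sum>i=1..Suc n. lam i) * (\<Prod>i=1..Suc n. h (2 * (of_nat (Suc n) - of_nat i)) * h (- part i - 1)) *
       (\<Prod>i=1..n. h (of_nat i - of_nat n))"
    by (simp only: mult_ac)
  also have "\<dots> = inverse t * (\<Prod>i=1..n. h (of_nat n - of_nat i) * h (of_nat i - of_nat n))"
    unfolding eq by (simp only: prod.distrib mult.assoc)
  also have "(\<Prod>i=1..n. h (of_nat n - of_nat i) * h (of_nat i - of_nat n)) = 1"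
  proof (rule prod.neutral, rule ballI)
    fix i
    show "h (of_nat n - of_nat i) * h (of_nat i - of_nat n) = 1"
      using h_add[of "of_nat n - of_nat i" "of_nat i - of_nat n"] by auto
  qed
  finally show ?thesis by simp
qed

text \<open>The two row sums are carried out one after the other, inside determinants. The
  multiplier on the left is the ratio of consecutive denominators, as \<open>denominator_Suc\<close>
  shows.\<close>

lemma det_branching:
  "(\<Sum>nu\<in>upper_rows \<epsilon> n lam. \<Sum>mu\<in>lower_rows \<epsilon> n nu.
     (if nu (Suc n) \<in> int_coset \<epsilon> then 1 else b) *
     h ((\<Sum>i=1..Suc n. lam i) - 2 * (\<Sum>i=1..Suc n. nu i) + (\<Sum>i=1..n. mu i)) *
     det_1n n (\<lambda>i j. \<phi> (mu i + of_nat n - of_nat i) j)) *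
   ((t - inverse t) * (\<Prod>j=1..n. ((y j)\<^sup>2 + inverse ((y j)\<^sup>2)) - (t + inverse t))) =
   det_1n (Suc n) (\<lambda>i j. \<phi> (lam i + of_nat (Suc n) - of_nat i) j)"
proof -
  define w where "w nu = (if nu (Suc n) \<in> int_coset \<epsilon> then 1 else b)" for nu :: "nat \<Rightarrow> rat"
  define X where "X mu = det_1n n (\<lambda>i j. \<phi> (mu i + of_nat n - of_nat i) j)" for mu
  define D where "D = (\<Prod>j=1..n. ((y j)\<^sup>2 + inverse ((y j)\<^sup>2)) - (t + inverse t))"
  define K where "K = h (\<Sum>i=1..Suc n. lam i) * (\<Prod>i=1..n. h (of_nat i - of_nat n))"
  define G where "G nu = det_1n (Suc n) (\<lambda>i j. g (round_up \<epsilon> (nu i) + of_nat (Suc n) - of_nat i) j)" for nu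
  define Z where "Z = (\<Sum>nu\<in>upper_rows \<epsilon> n lam. \<Sum>mu\<in>lower_rows \<epsilon> n nu.
     w nu * h ((\<Sum>i=1..Suc n. lam i) - 2 * (\<Sum>i=1..Suc n. nu i) + (\<Sum>i=1..n. mu i)) * X mu)"
  have split: "h ((\<Sum>i=1..Suc n. lam i) - 2 * (\<Sum>i=1..Suc n. nu i) + (\<Sum>i=1..n. mu i))
      = h (\<Sum>i=1..Suc n. lam i) * h (- 2 * (\<Sum>i=1..Suc n. nu i)) * h (\<Sum>i=1..n. mu i)"
    if nu: "nu \<in> upper_rows \<epsilon> n lam" and mu: "mu \<in> lower_rows \<epsilon> n nu" for nu mu
  proof -
    have "nu i \<in> half_lattice" if "i \<in> {1..Suc n}" for i
      using upper_rowsD(1)[OF nu] upper_rowsD(4)[OF nu, of i] that coset_half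
      by (cases "i = Suc n") auto
    then have "(\<Sum>i=1..Suc n. nu i) \<in> half_lattice" by (rule sum_in_half_lattice)
    then have *: "- 2 * (\<Sum>i=1..Suc n. nu i) \<in> half_lattice" by (rule minus_double_in_half_lattice)
    have **: "(\<Sum>i=1..Suc n. lam i) \<in> half_lattice" "(\<Sum>i=1..n. mu i) \<in> half_lattice"
      using coset_partitionD(1)[OF lam] lower_rowsD(1)[OF mu] coset_half
      by (auto intro!: sum_in_half_lattice simp del: sum.cl_ivl_Suc)
    have "h ((\<Sum>i=1..Suc n. lam i) - 2 * (\<Sum>i=1..Suc n. nu i) + (\<Sum>i=1..n. mu i))
      = h ((\<Sum>i=1..Suc n. lam i) + (- 2 * (\<Sum>i=1..Suc n. nu i)) + (\<Sum>i=1..n. mu i))"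
      by (simp del: sum.cl_ivl_Suc)
    then show ?thesis
      using h_add[OF half_lattice_closed(5)[OF **(1) *] **(2)] h_add[OF **(1) *] by (simp only:)
  qed
  have inner: "c * ((\<Sum>mu\<in>lower_rows \<epsilon> n nu.
     w nu * h ((\<Sum>i=1..Suc n. lam i) - 2 * (\<Sum>i=1..Suc n. nu i) + (\<Sum>i=1..n. mu i)) * X mu) * D)
     = K * (w nu * h (- 2 * (\<Sum>i=1..Suc n. nu i)) * G nu)"
    if nu: "nu \<in> upper_rows \<epsilon> n lam" for nu
  proof -
    define W where "W = (\<Sum>mu\<in>lower_rows \<epsilon> n nu. h (\<Sum>i=1..n. mu i) * X mu)"
    have sum_eq: "(\<Sum>mu\<in>lower_rows \<epsilon> n nu.
        w nu * h ((\<Sum>i=1..Suc n. lam i) - 2 * (\<Sum>i=1..Suc n. nu i) + (\<Sum>i=1..n. mu i)) * X mu)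
      = w nu * h (\<Sum>i=1..Suc n. lam i) * h (- 2 * (\<Sum>i=1..Suc n. nu i)) * W"
      unfolding W_def sum_distrib_left[of _ _ "lower_rows \<epsilon> n nu"]
    proof (intro sum.cong refl)
      fix mu assume "mu \<in> lower_rows \<epsilon> n nu"
      from split[OF nu this] show "w nu * h ((\<Sum>i=1..Suc n. lam i) - 2 * (\<Sum>i=1..Suc n. nu i) + (\<Sum>i=1..n. mu i)) * X mu
          = w nu * h (\<Sum>i=1..Suc n. lam i) * h (- 2 * (\<Sum>i=1..Suc n. nu i)) * (h (\<Sum>i=1..n. mu i) * X mu)"
        by (simp only: mult.assoc)
    qed
    have W: "c * (W * D) = (\<Prod>i=1..n. h (of_nat i - of_nat n)) * G nu"
      unfolding W_def X_def D_def sum_lower_rows[OF nu] G_def c_times_det[OF nu, symmetric]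
      by (rule mult.left_commute)
    have "c * (w nu * h (\<Sum>i=1..Suc n. lam i) * h (- 2 * (\<Sum>i=1..Suc n. nu i)) * W * D)
        = w nu * h (\<Sum>i=1..Suc n. lam i) * h (- 2 * (\<Sum>i=1..Suc n. nu i)) * (c * (W * D))"
      by (simp only: mult_ac)
    also have "\<dots> = K * (w nu * h (- 2 * (\<Sum>i=1..Suc n. nu i)) * G nu)"
      unfolding W K_def by (simp only: mult_ac)
    finally show ?thesis unfolding sum_eq .
  qed
  \<comment> \<open>The constant \<open>c\<close> is carried as a multiplier rather than divided
    out: of its factors only \<open>1 + b * t\<close> is assumed nonzero, and this one reappears on
    the right from the odd end.\<close>
  have "c * (Z * D) = K * (\<Sum>nu\<in>upper_rows \<epsilon> n lam. w nu * h (- 2 * (\<Sum>i=1..Suc n. nu i)) * G nu)"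
    unfolding Z_def sum_distrib_right[of _ _ D] sum_distrib_left[of c] sum_distrib_left[of K]
    using inner by (intro sum.cong refl) (simp only: sum_distrib_right sum_distrib_left[of c])
  also have "\<dots> = (1 + b * t) * (K * (\<Prod>i=1..Suc n. h (2 * (of_nat (Suc n) - of_nat i)) * h (- part i - 1))) *
      det_1n (Suc n) (\<lambda>i j. \<phi> (part i) j)"
    unfolding w_def G_def sum_upper_rows by (simp only: mult_ac)
  also have "\<dots> = (1 + b * t) * (inverse t * det_1n (Suc n) (\<lambda>i j. \<phi> (part i) j))"
    unfolding K_def power_bookkeeping by (simp only: mult.assoc)
  finally have "(1 - inverse t ^ 2) * (Z * D) = inverse t * det_1n (Suc n) (\<lambda>i j. \<phi> (part i) j)"
    using factor_nonzero by (simp add: c_def)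
  then have "t * ((1 - inverse t ^ 2) * (Z * D)) = det_1n (Suc n) (\<lambda>i j. \<phi> (part i) j)"
    using y_nonzero by simp
  moreover have "t * (1 - inverse t ^ 2) = t - inverse t"
    using y_nonzero by (simp add: field_simps power2_eq_square)
  ultimately have "Z * ((t - inverse t) * D) = det_1n (Suc n) (\<lambda>i j. \<phi> (part i) j)"
    by (simp only: mult.assoc[symmetric]) (simp only: mult_ac)
  then show ?thesis
    by (simp only: Z_def D_def X_def w_def part_def)
qed

end

subsection \<open>The two families of entries\<close>

lemma half_pow_shift:
  assumes "x \<noteq> 0" "q \<in> half_lattice"
  shows "half_pow x (q + 1) + half_pow x (q - 1) = (x\<^sup>2 + inverse (x\<^sup>2)) * half_pow x q"
  using assms by (simp add: half_pow_add half_pow_diff distrib_left divide_inverse mult.commute)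

definition entry_int :: "'a::field \<Rightarrow> (nat \<Rightarrow> 'a) \<Rightarrow> rat \<Rightarrow> nat \<Rightarrow> 'a" where
  "entry_int b y p j = half_pow (y j) (p + 1) - half_pow (y j) (- (p + 1))
     + b * (half_pow (y j) p - half_pow (y j) (- p))"

definition entry_half :: "'a::field \<Rightarrow> (nat \<Rightarrow> 'a) \<Rightarrow> rat \<Rightarrow> nat \<Rightarrow> 'a" where
  "entry_half b y p j = (b * half_pow (y j) (1/2) + half_pow (y j) (- (1/2))) *
     (half_pow (y j) (p + 1/2) - half_pow (y j) (- (p + 1/2)))"

text \<open>As functions of \<open>p\<close>, both entries are combinations of
  \<open>half_pow (y j) p\<close> and \<open>half_pow (y j) (- p)\<close> with coefficients free of
  \<open>p\<close>, and these two powers solve the recurrence.\<close>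

lemma entry_recurrence:
  assumes y: "y j \<noteq> 0" and p: "p \<in> half_lattice"
  shows "entry_int b y (p + 1) j + entry_int b y (p - 1) j
      = ((y j)\<^sup>2 + inverse ((y j)\<^sup>2)) * entry_int b y p j"
    and "entry_half b y (p + 1) j + entry_half b y (p - 1) j
      = ((y j)\<^sup>2 + inverse ((y j)\<^sup>2)) * entry_half b y p j"
proof -
  let ?h = "half_pow (y j)" and ?u = "(y j)\<^sup>2 + inverse ((y j)\<^sup>2)"
  have shift: "?h (p + 1 + q) + ?h (p - 1 + q) = ?u * ?h (p + q)"
    "?h (- (p + 1 + q)) + ?h (- (p - 1 + q)) = ?u * ?h (- (p + q))" if "q \<in> half_lattice" for q
  proof -
    have *: "p + q \<in> half_lattice" "- (p + q) \<in> half_lattice"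
      using that p by (auto simp del: minus_add_distrib)
    show "?h (p + 1 + q) + ?h (p - 1 + q) = ?u * ?h (p + q)"
      using half_pow_shift[OF y *(1)] by (simp add: algebra_simps)
    show "?h (- (p + 1 + q)) + ?h (- (p - 1 + q)) = ?u * ?h (- (p + q))"
    proof -
      \<comment> \<open>Negation exchanges the upper and the lower neighbour, hence the commutation
        below.\<close>
      have e: "- (p + 1 + q) = - (p + q) - 1" "- (p - 1 + q) = - (p + q) + 1" by simp_all
      show ?thesis unfolding e add.commute[of "?h (- (p + q) - 1)"] by (rule half_pow_shift[OF y *(2)])
    qed
  qed
  have "entry_int b y (p + 1) j + entry_int b y (p - 1) j
      = (?h (p + 1 + 1) + ?h (p - 1 + 1)) - (?h (- (p + 1 + 1)) + ?h (- (p - 1 + 1)))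
        + b * ((?h (p + 1 + 0) + ?h (p - 1 + 0)) - (?h (- (p + 1 + 0)) + ?h (- (p - 1 + 0))))"
    unfolding entry_int_def by (simp add: right_diff_distrib distrib_left)
  also have "\<dots> = ?u * entry_int b y p j"
    unfolding shift[OF half_lattice_closed(1)] shift[OF half_lattice_closed(2)] entry_int_def
    by (simp add: right_diff_distrib distrib_left mult.left_commute)
  finally show "entry_int b y (p + 1) j + entry_int b y (p - 1) j = ?u * entry_int b y p j" .
  have "entry_half b y (p + 1) j + entry_half b y (p - 1) j
      = (b * ?h (1/2) + ?h (- (1/2))) *
        ((?h (p + 1 + 1/2) + ?h (p - 1 + 1/2)) - (?h (- (p + 1 + 1/2)) + ?h (- (p - 1 + 1/2))))"
    unfolding entry_half_def by (simp only: right_diff_distrib distrib_left) simp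
  also have "\<dots> = ?u * entry_half b y p j"
    unfolding shift[OF half_lattice_closed(4)] entry_half_def
    by (simp only: right_diff_distrib mult.left_commute)
  finally show "entry_half b y (p + 1) j + entry_half b y (p - 1) j = ?u * entry_half b y p j" .
qed

text \<open>With x the square of \<open>y j\<close>, both entries are a multiple of x^p minus (1/x +
  b) x^(-p). The Casoratian with x^p ignores the first term, and the second gives (1/x + b)(x -
  1/x), the same value in both families.\<close>

lemma entry_casorati:
  assumes y: "y j \<noteq> 0" and p: "p \<in> half_lattice"
  shows "half_pow (y j) (p - 1) * entry_int b y p j - half_pow (y j) p * entry_int b y (p - 1) j
      = (1 - inverse ((y j)\<^sup>2) ^ 2) * (1 + b * (y j)\<^sup>2)"
    and "half_pow (y j) (p - 1) * entry_half b y p j - half_pow (y j) p * entry_half b y (p - 1) j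
      = (1 - inverse ((y j)\<^sup>2) ^ 2) * (1 + b * (y j)\<^sup>2)"
proof -
  define x a where "x = y j" and "a = half_pow x p"
  have nz: "x \<noteq> 0" "a \<noteq> 0" using y by (simp_all add: x_def a_def)
  note rules = half_pow_add[OF nz(1)] half_pow_diff[OF nz(1)] half_pow_minus[OF nz(1)]
  have half: "p + 1/2 \<in> half_lattice" "p - 1/2 \<in> half_lattice" "p + 1 \<in> half_lattice" "p - 1 \<in> half_lattice"
    using p by (simp_all del: half_lattice_closed(4) add: half_lattice_closed(4))
  have h: "half_pow x (p - 1) = a / x\<^sup>2" "half_pow x (p + 1) = a * x\<^sup>2"
      "half_pow x (p + 1/2) = a * x" "half_pow x (p - 1/2) = a / x"
    using p half_lattice_closed(2,4) by (simp_all only: rules a_def half_pow_1 half_pow_half)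
  have h': "half_pow x (- (p - 1)) = x\<^sup>2 / a" "half_pow x (- (p + 1)) = 1 / (a * x\<^sup>2)"
      "half_pow x (- (p + 1/2)) = 1 / (a * x)" "half_pow x (- (p - 1/2)) = x / a" "half_pow x (- p) = 1 / a"
      "half_pow x (- (1/2)) = 1 / x"
    using half p half_lattice_closed(4) nz
    by (simp_all only: rules(3) h half_pow_half a_def[symmetric]) (simp_all add: field_simps)
  have e: "p - 1 + 1 = p" "p - 1 + 1/2 = p - 1/2" by simp_all
  show "half_pow (y j) (p - 1) * entry_int b y p j - half_pow (y j) p * entry_int b y (p - 1) j
      = (1 - inverse ((y j)\<^sup>2) ^ 2) * (1 + b * (y j)\<^sup>2)"
    unfolding entry_int_def x_def[symmetric] e h h' a_def[symmetric]
    using nz by (simp add: field_simps power2_eq_square)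
  show "half_pow (y j) (p - 1) * entry_half b y p j - half_pow (y j) p * entry_half b y (p - 1) j
      = (1 - inverse ((y j)\<^sup>2) ^ 2) * (1 + b * (y j)\<^sup>2)"
    unfolding entry_half_def x_def[symmetric] e h h' a_def[symmetric] half_pow_half
    using nz by (simp add: field_simps power2_eq_square)
qed

text \<open>For \<open>\<epsilon> = 0\<close> the entry at -1 is -b times the entry at 0. For
  \<open>\<epsilon> = 1/2\<close> both indices are -1/2, where the second factor of the entry
  vanishes.\<close>

lemma entry_boundary:
  "half_pow s (- 0) * entry_int b y (0 - 1) j + b * half_pow s 0 * entry_int b y (- 0) j = 0"
  "half_pow s (- (1/2)) * entry_half b y (1/2 - 1) j + b * half_pow s (1/2) * entry_half b y (- (1/2)) j = 0"
  by (simp_all add: entry_int_def entry_half_def algebra_simps)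


subsection \<open>The bialternant formula\<close>

definition denominator :: "nat \<Rightarrow> (nat \<Rightarrow> 'a::field) \<Rightarrow> 'a" where
  "denominator n y = det_1n n (\<lambda>i j. half_pow (y j) (of_nat n - of_nat i + 1)
     - half_pow (y j) (- (of_nat n - of_nat i + 1)))"

text \<open>
  The denominator is itself the numerator for \<open>\<lambda> = 0\<close> and \<open>\<beta> = 0\<close>, where only the zero rows
  contribute to the branching rule, so its product formula needs no separate proof.
\<close>

lemma denominator_Suc:
  assumes y: "\<And>j. y j \<noteq> 0"
  shows "denominator (Suc n) y = denominator n y *
    (((y (Suc n))\<^sup>2 - inverse ((y (Suc n))\<^sup>2)) *
     (\<Prod>j=1..n. ((y j)\<^sup>2 + inverse ((y j)\<^sup>2)) - ((y (Suc n))\<^sup>2 + inverse ((y (Suc n))\<^sup>2))))"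
proof -
  have half: "p \<in> half_lattice" if "p \<in> int_coset 0" for p
    using int_coset_sub_half_lattice[of 0] that by auto
  interpret branching 0 n y 0 "entry_int 0 y" "\<lambda>_. 0"
  proof
    show "coset_partition 0 (Suc n) (\<lambda>_. 0)" by (simp add: coset_partition_def int_coset_0)
  next
    fix j
    show "half_pow (y (Suc n)) (- 0) * entry_int 0 y (0 - 1) j
        + 0 * half_pow (y (Suc n)) 0 * entry_int 0 y (- 0) j = 0"
      by (rule entry_boundary(1))
  qed (use y half entry_recurrence(1)[of y, OF y] entry_casorati(1)[of y, OF y] in auto)
  \<comment> \<open>For the zero shape every interval shrinks to a point, the odd end included, so
    the double sum has a single term, of weight 1.\<close>
  have I: "coset_interval 0 0 0 = {0}" "{p \<in> half_lattice. 0 \<le> p \<and> p \<le> 0} = {0}"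
    by (auto simp: coset_interval_def int_coset_0)
  have U: "upper_rows 0 n (\<lambda>_. 0) = {\<lambda>i\<in>{1..Suc n}. 0}"
    unfolding upper_rows_def I if_cancel
    using PiE_singleton[of "\<lambda>i\<in>{1..Suc n}. 0::rat" "{1..Suc n}"]
    by (simp cong: PiE_cong)
  have L: "lower_rows 0 n (\<lambda>i\<in>{1..Suc n}. 0) = {\<lambda>i\<in>{1..n}. 0}"
  proof -
    have "lower_rows 0 n (\<lambda>i\<in>{1..Suc n}. 0) = Pi\<^sub>E {1..n} (\<lambda>i. {(\<lambda>i\<in>{1..n}. 0) i})"
      unfolding lower_rows_def by (rule PiE_cong) (simp add: I)
    then show ?thesis using PiE_singleton[of "\<lambda>i\<in>{1..n}. 0::rat" "{1..n}"] by simp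
  qed
  have D: "det_1n m (\<lambda>i j. entry_int 0 y (f i + of_nat m - of_nat i) j) = denominator m y"
    if "\<And>i. i \<in> {1..m} \<Longrightarrow> f i = 0" for m f
    unfolding denominator_def using that by (intro det_1n_cong) (simp add: entry_int_def)
  have "denominator (Suc n) y = det_1n (Suc n) (\<lambda>i j. entry_int 0 y (0 + of_nat (Suc n) - of_nat i) j)"
    by (rule D[symmetric]) simp
  also note det_branching[symmetric]
  also have "(\<Sum>nu\<in>upper_rows 0 n (\<lambda>_. 0). \<Sum>mu\<in>lower_rows 0 n nu.
     (if nu (Suc n) \<in> int_coset 0 then 1 else 0) *
     h ((\<Sum>i=1..Suc n. 0) - 2 * (\<Sum>i=1..Suc n. nu i) + (\<Sum>i=1..n. mu i)) *
     det_1n n (\<lambda>i j. entry_int 0 y (mu i + of_nat n - of_nat i) j)) = denominator n y"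
    unfolding U
    by (simp add: L[unfolded One_nat_def] D[of n "\<lambda>i\<in>{1..n}. 0", simplified] int_coset_0)
  finally show ?thesis .
qed

text \<open>The factors gained in \<open>denominator_Suc\<close> are those of the Weyl denominator
  of type C, and the hypotheses say that none of them vanishes.\<close>

lemma denominator_nonzero:
  assumes "\<And>j. y j \<noteq> 0" "\<And>j. (y j)\<^sup>2 \<noteq> inverse ((y j)\<^sup>2)"
    and "\<And>i j. i \<noteq> j \<Longrightarrow> (y i)\<^sup>2 + inverse ((y i)\<^sup>2) \<noteq> (y j)\<^sup>2 + inverse ((y j)\<^sup>2)"
  shows "denominator n y \<noteq> 0"
proof (induction n)
  case 0
  show ?case by (simp add: denominator_def)
next
  case (Suc n)
  have "(\<Prod>j=1..n. ((y j)\<^sup>2 + inverse ((y j)\<^sup>2)) - ((y (Suc n))\<^sup>2 + inverse ((y (Suc n))\<^sup>2))) \<noteq> 0"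
    using assms(3) by (auto simp del: power2_eq_iff)
  then show ?case
    using Suc.IH assms(2)[of "Suc n"] unfolding denominator_Suc[OF assms(1)] by simp
qed

text \<open>Patterns and determinants obey the same branching rule, up to the ratio of consecutive
  denominators. The conditions are asked of every variable because each one is the last at some
  stage of the induction.\<close>

lemma schur_CB_times_denominator:
  assumes eps: "\<epsilon> = 0 \<or> \<epsilon> = 1/2"
    and y: "\<And>j. y j \<noteq> 0" and factor: "\<And>j. 1 + b * (y j)\<^sup>2 \<noteq> 0"
    and recurrence: "\<And>p j. p \<in> int_coset \<epsilon> \<Longrightarrow>
       \<phi> (p + 1) j + \<phi> (p - 1) j = ((y j)\<^sup>2 + inverse ((y j)\<^sup>2)) * \<phi> p j"
    and casorati: "\<And>p j. p \<in> int_coset \<epsilon> \<Longrightarrow>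
       half_pow (y j) (p - 1) * \<phi> p j - half_pow (y j) p * \<phi> (p - 1) j
       = (1 - inverse ((y j)\<^sup>2) ^ 2) * (1 + b * (y j)\<^sup>2)"
    and boundary: "\<And>i j. half_pow (y i) (- \<epsilon>) * \<phi> (\<epsilon> - 1) j + b * half_pow (y i) \<epsilon> * \<phi> (- \<epsilon>) j = 0"
    and lam: "coset_partition \<epsilon> n lam"
  shows "schur_CB n lam y b * denominator n y = det_1n n (\<lambda>i j. \<phi> (lam i + of_nat n - of_nat i) j)"
  using lam
proof (induction n arbitrary: lam)
  case 0
  show ?case by (simp add: denominator_def)
next
  case (Suc n)
  interpret branching \<epsilon> n y b \<phi> lam
    by unfold_locales (use eps y factor recurrence casorati boundary Suc.prems in auto)
  define E where "E = ((t - inverse t) * (\<Prod>j=1..n. ((y j)\<^sup>2 + inverse ((y j)\<^sup>2)) - (t + inverse t)))"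
  define k where "k nu mu = (if nu (Suc n) \<in> int_coset \<epsilon> then 1 else b) *
     h ((\<Sum>i=1..Suc n. lam i) - 2 * (\<Sum>i=1..Suc n. nu i) + (\<Sum>i=1..n. mu i))"
    for nu mu :: "nat \<Rightarrow> rat"
  have "schur_CB (Suc n) lam y b * denominator (Suc n) y
      = (\<Sum>nu\<in>upper_rows \<epsilon> n lam. \<Sum>mu\<in>lower_rows \<epsilon> n nu. k nu mu * schur_CB n mu y b) * (denominator n y * E)"
    unfolding schur_CB_Suc[OF eps Suc.prems] denominator_Suc[OF y] E_def k_def ..
  also have "\<dots> = (\<Sum>nu\<in>upper_rows \<epsilon> n lam. \<Sum>mu\<in>lower_rows \<epsilon> n nu. k nu mu * (schur_CB n mu y b * denominator n y)) * E"
    by (simp only: sum_distrib_right sum_distrib_left mult_ac)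
  also have "\<dots> = (\<Sum>nu\<in>upper_rows \<epsilon> n lam. \<Sum>mu\<in>lower_rows \<epsilon> n nu. k nu mu *
      det_1n n (\<lambda>i j. \<phi> (mu i + of_nat n - of_nat i) j)) * E"
    using Suc.IH lower_rows_coset_partition[OF Suc.prems]
    by (intro arg_cong2[of _ _ _ _ "(*)"] sum.cong refl) auto
  also have "\<dots> = det_1n (Suc n) (\<lambda>i j. \<phi> (lam i + of_nat (Suc n) - of_nat i) j)"
    unfolding k_def E_def by (rule det_branching)
  finally show ?case .
qed


subsection \<open>Genericity of the indeterminates\<close>

lemma Fract_1_eq_iff: "Fract a 1 = Fract b 1 \<longleftrightarrow> a = b" for a b :: "'a::idom"
  by (simp add: eq_fract)

lemma single_1_eq_iff: "Poly_Mapping.single k (1::'a::zero_neq_one) = Poly_Mapping.single l 1 \<longleftrightarrow> k = l"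
  by (metis lookup_single_eq lookup_single_not_eq zero_neq_one)

definition monomial_x :: "(nat \<Rightarrow>\<^sub>0 nat) \<Rightarrow> 'k::field ratfun" where
  "monomial_x e = Fract (Poly_Mapping.single e 1) 1"

lemma monomial_x_mult: "monomial_x d * monomial_x e = monomial_x (d + e)"
  by (simp add: monomial_x_def mult_single)

lemma monomial_x_eq_iff [simp]: "(monomial_x d :: 'k::field ratfun) = monomial_x e \<longleftrightarrow> d = e"
  by (simp add: monomial_x_def Fract_1_eq_iff single_1_eq_iff)

lemma monomial_x_0: "monomial_x 0 = 1"
  by (simp add: monomial_x_def One_fract_def)

lemma root_x_square: "(root_x i)\<^sup>2 = monomial_x (Poly_Mapping.single i 2)"
proof -
  have "(root_x i)\<^sup>2 = monomial_x (Poly_Mapping.single i 1 + Poly_Mapping.single i 1)"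
    unfolding power2_eq_square monomial_x_mult[symmetric] by (simp add: root_x_def monomial_x_def)
  then show ?thesis by (simp only: single_add[symmetric] one_add_one)
qed

lemma root_x_nonzero: "(root_x i :: 'k::field ratfun) \<noteq> 0"
proof
  assume "(root_x i :: 'k ratfun) = 0"
  then have "Poly_Mapping.single (Poly_Mapping.single i (1 :: nat)) (1 :: 'k) = 0"
    by (simp only: root_x_def Zero_fract_def Fract_1_eq_iff)
  then show False by (metis lookup_single_eq lookup_zero zero_neq_one)
qed

text \<open>The product is a monomial of nonzero exponent. The case \<open>i = j\<close> is included
  and keeps a variable apart from its inverse.\<close>

lemma root_x_square_mult_ne_1: "(root_x i)\<^sup>2 * (root_x j)\<^sup>2 \<noteq> (1 :: 'k::field ratfun)"
proof -
  have "Poly_Mapping.lookup (Poly_Mapping.single i 2 + Poly_Mapping.single j 2) i \<noteq> (0::nat)"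
    by (simp add: lookup_add)
  then have "Poly_Mapping.single i (2::nat) + Poly_Mapping.single j 2 \<noteq> 0"
    by (metis lookup_zero)
  then show ?thesis
    unfolding root_x_square monomial_x_mult monomial_x_0[symmetric] monomial_x_eq_iff .
qed

lemma root_x_square_ne_inverse: "(root_x i :: 'k::field ratfun)\<^sup>2 \<noteq> inverse ((root_x i)\<^sup>2)"
proof
  assume "(root_x i :: 'k ratfun)\<^sup>2 = inverse ((root_x i)\<^sup>2)"
  then have "(root_x i :: 'k ratfun)\<^sup>2 * (root_x i)\<^sup>2 = (root_x i)\<^sup>2 * inverse ((root_x i)\<^sup>2)"
    by (rule arg_cong)
  also have "\<dots> = 1" by (rule right_inverse) (simp add: root_x_nonzero)
  finally show False using root_x_square_mult_ne_1 by blast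
qed

lemma root_x_separated:
  assumes "i \<noteq> j"
  shows "(root_x i :: 'k::field ratfun)\<^sup>2 + inverse ((root_x i)\<^sup>2) \<noteq> (root_x j)\<^sup>2 + inverse ((root_x j)\<^sup>2)"
proof
  define a b :: "'k ratfun" where "a = (root_x i)\<^sup>2" and "b = (root_x j)\<^sup>2"
  have nz: "a \<noteq> 0" "b \<noteq> 0" by (simp_all add: a_def b_def root_x_nonzero)
  assume "(root_x i :: 'k ratfun)\<^sup>2 + inverse ((root_x i)\<^sup>2) = (root_x j)\<^sup>2 + inverse ((root_x j)\<^sup>2)"
  then have "a + inverse a = b + inverse b" by (simp only: a_def b_def)
  \<comment> \<open>Multiplying the equation by \<open>a * b\<close> makes the difference of its
    sides factor.\<close>
  then have "(a - b) * (a * b - 1) = 0"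
    using nz by (simp add: field_simps)
  moreover have "a * b \<noteq> 1" unfolding a_def b_def by (rule root_x_square_mult_ne_1)
  moreover have "a \<noteq> b"
  proof -
    have "Poly_Mapping.single i (2::nat) \<noteq> Poly_Mapping.single j 2"
      using assms by (metis lookup_single_eq lookup_single_not_eq zero_neq_numeral)
    then show ?thesis unfolding a_def b_def root_x_square monomial_x_eq_iff .
  qed
  ultimately show False by simp
qed

text \<open>The constant coefficient is 1, whatever \<beta> is.\<close>

lemma factor_root_x_nonzero: "1 + const_ratfun \<beta> * (root_x i)\<^sup>2 \<noteq> (0 :: 'k::field ratfun)"
proof
  let ?m = "Poly_Mapping.single i (2::nat)"
  assume "1 + const_ratfun \<beta> * (root_x i)\<^sup>2 = (0 :: 'k ratfun)"
  then have "Fract (1 + Poly_Mapping.single ?m \<beta>) 1 = Fract 0 1"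
    unfolding root_x_square monomial_x_def const_ratfun_def One_fract_def Zero_fract_def
    by (simp add: mult_single)
  then have "1 + Poly_Mapping.single ?m \<beta> = 0" by (simp only: Fract_1_eq_iff)
  then have "Poly_Mapping.lookup (1 + Poly_Mapping.single ?m \<beta>) 0 = 0" by (simp only: lookup_zero)
  moreover have "?m \<noteq> 0" by (metis lookup_single_eq lookup_zero zero_neq_numeral)
  ultimately show False
    by (simp add: lookup_add lookup_one lookup_single when_def)
qed

theorem theorem3p5:
  fixes n :: nat and lam :: "nat \<Rightarrow> rat" and \<beta> :: "'k::field"
  assumes "n \<ge> 1"
  shows
    "(is_partition n lam \<longrightarrow>
       schur_CB n lam root_x (const_ratfun \<beta>) =
         det_1n n (\<lambda>i j.
           half_pow (root_x j) (lam i + of_nat n - of_nat i + 1)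
           - half_pow (root_x j) (- (lam i + of_nat n - of_nat i + 1))
           + const_ratfun \<beta> *
             (half_pow (root_x j) (lam i + of_nat n - of_nat i)
              - half_pow (root_x j) (- (lam i + of_nat n - of_nat i))))
         / det_1n n (\<lambda>i j.
             half_pow (root_x j) (of_nat n - of_nat i + 1)
             - half_pow (root_x j) (- (of_nat n - of_nat i + 1))))
     \<and>
     (is_half_partition n lam \<longrightarrow>
       schur_CB n lam root_x (const_ratfun \<beta>) =
         det_1n n (\<lambda>i j.
           (const_ratfun \<beta> * half_pow (root_x j) (1/2) + half_pow (root_x j) (- (1/2))) *
           (half_pow (root_x j) (lam i + of_nat n - of_nat i + 1/2)
            - half_pow (root_x j) (- (lam i + of_nat n - of_nat i + 1/2))))
         / det_1n n (\<lambda>i j.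
             half_pow (root_x j) (of_nat n - of_nat i + 1)
             - half_pow (root_x j) (- (of_nat n - of_nat i + 1))))"
proof -
  let ?b = "const_ratfun \<beta>" and ?y = "root_x :: nat \<Rightarrow> 'k ratfun"
  have nz: "denominator n ?y \<noteq> 0"
    by (intro denominator_nonzero root_x_nonzero root_x_square_ne_inverse root_x_separated)
  have half: "p \<in> half_lattice" if "p \<in> int_coset 0 \<or> p \<in> int_coset (1/2)" for p
    using int_coset_sub_half_lattice[of 0] int_coset_sub_half_lattice[of "1/2"] that by blast
  have int: "schur_CB n lam ?y ?b * denominator n ?y
      = det_1n n (\<lambda>i j. entry_int ?b ?y (lam i + of_nat n - of_nat i) j)" if "is_partition n lam"
    using that unfolding coset_partition_0[symmetric]
    \<comment> \<open>The rotation puts the premise about the shape first, so that the chained fact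
      determines \<open>\<epsilon>\<close>.\<close>
    by (rule schur_CB_times_denominator[rotated -1])
       (intro disjI1 refl root_x_nonzero factor_root_x_nonzero entry_recurrence entry_casorati
          entry_boundary half disjI1 | assumption)+
  have half_int: "schur_CB n lam ?y ?b * denominator n ?y
      = det_1n n (\<lambda>i j. entry_half ?b ?y (lam i + of_nat n - of_nat i) j)" if "is_half_partition n lam"
    using that unfolding coset_partition_half[symmetric]
    by (rule schur_CB_times_denominator[rotated -1])
       (intro disjI2 refl root_x_nonzero factor_root_x_nonzero entry_recurrence entry_casorati
          entry_boundary half disjI2 | assumption)+
  show ?thesis
    by (intro conjI impI eq_divide_imp nz[unfolded denominator_def]
        int[unfolded denominator_def entry_int_def] half_int[unfolded denominator_def entry_half_def])
qed

end
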